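(* Let $d\in\mathbb{N}$, $\Omega=\Omega_1\times\cdots\times\Omega_d\subseteq\mathbb{R}^d$ with $\mu(\Omega)<\infty$, let $\vec p=(p_1,\dots,p_d)$ with $0<p_i\le\infty$ for all $i$ and $0<\min\{p_1,\dots,p_d\}<\infty$, and let $0<q\le\infty$. Then the growth envelope of the mixed Lorentz space $L_{\vec p,q}(\Omega)$ is $$\mathfrak{E}_{\mathsf G}(L_{\vec p,q}(\Omega))=\left(t^{-1/\min\{p_1,\dots,p_d\}},\ q\right).$$
   Context: Setting: $\Omega_1,\dots,\Omega_d\subseteq\mathbb{R}$ are Lebesgue measurable sets of positive measure, $\Omega=\prod_i\Omega_i$, and $\mu$ is Lebesgue measure on $\Omega$. Mixed Lebesgue quasi-norm: for measurable $f:\Omega\to\mathbb{R}$, $$\|f\|_{\vec p}=\left(\int_{\Omega_d}\cdots\left(\int_{\Omega_1}|f(x_1,\dots,x_d)|^{p_1}\,dx_1\right)^{p_2/p_1}\cdots\,dx_d\right)^{1/p_d},$$ i.e. one takes the $L_{p_1}$ quasi-norm in $x_1$, then the $L_{p_2}$ quasi-norm in $x_2$, etc., with the essential supremum in $x_j$ if $p_j=\infty$. Mixed Lorentz space: $L_{\vec p,q}(\Omega)$ consists of the measurable $f$ with finite quasi-norm $$\|f\|_{L_{\vec p,q}}=\left(\int_0^\infty u^q\,\|\chi_{\{|f|>u\}}\|_{\vec p}^q\,\frac{du}{u}\right)^{1/q}\ (0<q<\infty),\qquad \|f\|_{L_{\vec p,\infty}}=\sup_{u>0}u\,\|\chi_{\{|f|>u\}}\|_{\vec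 p},$$ where $\chi_A$ denotes the characteristic function of $A$. Rearrangement: $\mu_f(s)=\mu(\{|f|>s\})$ and $f^*(t)=\inf\{s>0:\mu_f(s)\le t\}$ for $t\ge0$ (with $\inf\emptyset=\infty$). Growth envelope: for a quasi-normed function space $X$ on $\Omega$, $\mathcal{E}_{\mathsf G}^X(t)=\sup\{f^*(t):\|f\|_X\le1\}$, $t>0$. Growth envelope functions are considered up to equivalence near $0$. For a positive, decreasing, continuously differentiable function $\Psi$ and $u\in(0,\infty]$, the equality $\mathfrak{E}_{\mathsf G}(X)=(\Psi(t),u)$ means: (i) there are $\varepsilon>0$ and constants $A,B>0$ with $A\,\Psi(t)\le\mathcal{E}_{\mathsf G}^X(t)\le B\,\Psi(t)$ for $0<t<\varepsilon$; and (ii) $u$ is the infimum of all $0<v\le\infty$ for which, for some $c>0$ and a fixed sufficiently small $\varepsilon>0$, $$\left(-\int_0^\varepsilon\left(\frac{f^*(t)}{\Psi(t)}\right)^v\frac{\Psi'(t)}{\Psi(t)}\,dt\right)^{1/v}\le c\,\|f\|_X\quad\text{for all }f\in X$$ (for $v=\infty$: $\sup_{0<t<\varepsilon}f^*(t)/\Psi(t)\le c\|f\|_X$). For $\Psi(t)=t^{-1/r}$ the measure $-\frac{\Psi'(t)}{\Psi(t)}dt$ is a constant multiple of $\frac{dt}{t}$. *)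

theory Defs
  imports "HOL-Analysis.Analysis" "HOL-Probability.Essential_Supremum"
begin

text \<open>
  A point of \<open>\<real>\<^sup>d\<close> is an extensional function on \<open>{..<d}\<close>, so the coordinates \<open>x\<^sub>1, \<dots>, x\<^sub>d\<close> of the
  mathematical text are \<open>x 0, \<dots>, x (d - 1)\<close>. Exponents in \<open>(0, \<infinity>]\<close> are elements of \<^typ>\<open>ennreal\<close>.
\<close>

text \<open>Only used with a positive exponent \<open>r\<close>, for which \<open>\<infinity>\<^sup>r = \<infinity>\<close> and \<open>0\<^sup>r = 0\<close>.\<close>

definition enn_powr :: "ennreal \<Rightarrow> real \<Rightarrow> ennreal" where
  "enn_powr x r = (if x = top then top else ennreal (enn2real x powr r))"

definition Lp_qnorm :: "'a measure \<Rightarrow> ennreal \<Rightarrow> ('a \<Rightarrow> ennreal) \<Rightarrow> ennreal" where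
  "Lp_qnorm M p F =
     (if p = top then esssup M F
      else enn_powr (\<integral>\<^sup>+ x. enn_powr (F x) (enn2real p) \<partial>M) (1 / enn2real p))"

subsection \<open>Mixed Lebesgue and mixed Lorentz quasi-norms\<close>

definition box_set :: "nat \<Rightarrow> (nat \<Rightarrow> real set) \<Rightarrow> (nat \<Rightarrow> real) set" where
  "box_set d \<Omega> = PiE {..<d} \<Omega>"

text \<open>
  Lebesgue measure on \<open>\<Omega>\<^sub>1 \<times> \<dots> \<times> \<Omega>\<^sub>d\<close>. The completion makes measurability with respect to this
  measure Lebesgue (not merely Borel) measurability on \<open>\<real>\<^sup>d\<close>.
\<close>

definition box_measure :: "nat \<Rightarrow> (nat \<Rightarrow> real set) \<Rightarrow> (nat \<Rightarrow> real) measure" where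
  "box_measure d \<Omega> =
     restrict_space (completion (Pi\<^sub>M {..<d} (\<lambda>_. lborel :: real measure))) (box_set d \<Omega>)"

text \<open>
  \<open>mixed_partial \<Omega> p k F x\<close> is the result of taking the quasi-norms in the first \<open>k\<close> coordinates,
  the coordinate with index \<open>0\<close> innermost; it depends on the remaining coordinates of \<open>x\<close> only.
\<close>

primrec mixed_partial ::
  "(nat \<Rightarrow> real set) \<Rightarrow> (nat \<Rightarrow> ennreal) \<Rightarrow> nat \<Rightarrow> ((nat \<Rightarrow> real) \<Rightarrow> ennreal) \<Rightarrow> (nat \<Rightarrow> real) \<Rightarrow> ennreal"
where
  "mixed_partial \<Omega> p 0 F = F"
| "mixed_partial \<Omega> p (Suc k) F =
     (\<lambda>x. Lp_qnorm (lebesgue_on (\<Omega> k)) (p k) (\<lambda>s. mixed_partial \<Omega> p k F (x(k := s))))"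

text \<open>
  After all \<open>d\<close> coordinates have been integrated out, the base point no longer matters; with the
  one chosen here, all arguments passed to \<open>f\<close> are points of \<^term>\<open>box_set d \<Omega>\<close>.
\<close>

definition mixed_norm ::
  "nat \<Rightarrow> (nat \<Rightarrow> real set) \<Rightarrow> (nat \<Rightarrow> ennreal) \<Rightarrow> ((nat \<Rightarrow> real) \<Rightarrow> real) \<Rightarrow> ennreal" where
  "mixed_norm d \<Omega> p f = mixed_partial \<Omega> p d (\<lambda>x. ennreal \<bar>f x\<bar>) (\<lambda>_. undefined)"

definition mixed_lorentz_norm ::
  "nat \<Rightarrow> (nat \<Rightarrow> real set) \<Rightarrow> (nat \<Rightarrow> ennreal) \<Rightarrow> ennreal \<Rightarrow> ((nat \<Rightarrow> real) \<Rightarrow> real) \<Rightarrow> ennreal" where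
  "mixed_lorentz_norm d \<Omega> p q f =
     (let N = (\<lambda>u. mixed_norm d \<Omega> p (indicat_real {x \<in> box_set d \<Omega>. \<bar>f x\<bar> > u})) in
      if q = top then (SUP u\<in>{0<..}. ennreal u * N u)
      else enn_powr
        (\<integral>\<^sup>+ u\<in>{0<..}. ennreal (u powr enn2real q) * enn_powr (N u) (enn2real q) / ennreal u \<partial>lborel)
        (1 / enn2real q))"

definition mixed_lorentz_space ::
  "nat \<Rightarrow> (nat \<Rightarrow> real set) \<Rightarrow> (nat \<Rightarrow> ennreal) \<Rightarrow> ennreal \<Rightarrow> ((nat \<Rightarrow> real) \<Rightarrow> real) set" where
  "mixed_lorentz_space d \<Omega> p q =
     {f \<in> borel_measurable (box_measure d \<Omega>). mixed_lorentz_norm d \<Omega> p q f < top}"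

subsection \<open>Rearrangement and growth envelopes\<close>

definition distr_fun :: "'a measure \<Rightarrow> ('a \<Rightarrow> real) \<Rightarrow> real \<Rightarrow> ennreal" where
  "distr_fun M f s = emeasure M {x \<in> space M. \<bar>f x\<bar> > s}"

definition rearr :: "'a measure \<Rightarrow> ('a \<Rightarrow> real) \<Rightarrow> real \<Rightarrow> ennreal" where
  "rearr M f t = (INF s\<in>{s. 0 < s \<and> distr_fun M f s \<le> ennreal t}. ennreal s)"

text \<open>
  A function space over \<open>M\<close> is given by its set \<open>X\<close> of elements and its quasi-norm \<open>N\<close>.
\<close>

definition growth_envelope_fun ::
  "'a measure \<Rightarrow> ('a \<Rightarrow> real) set \<Rightarrow> (('a \<Rightarrow> real) \<Rightarrow> ennreal) \<Rightarrow> real \<Rightarrow> ennreal" where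
  "growth_envelope_fun M X N t = (SUP f\<in>{f \<in> X. N f \<le> 1}. rearr M f t)"

definition envelope_integral ::
  "'a measure \<Rightarrow> (real \<Rightarrow> real) \<Rightarrow> ennreal \<Rightarrow> real \<Rightarrow> ('a \<Rightarrow> real) \<Rightarrow> ennreal" where
  "envelope_integral M \<Psi> v \<epsilon> f =
     (if v = top then (SUP t\<in>{0<..<\<epsilon>}. rearr M f t / ennreal (\<Psi> t))
      else enn_powr
        (\<integral>\<^sup>+ t\<in>{0<..<\<epsilon>}. enn_powr (rearr M f t / ennreal (\<Psi> t)) (enn2real v)
                            * ennreal (- deriv \<Psi> t / \<Psi> t) \<partial>lborel)
        (1 / enn2real v))"

definition envelope_gauge :: "(real \<Rightarrow> real) \<Rightarrow> bool" where
  "envelope_gauge \<Psi> \<longleftrightarrow>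
     (\<forall>t>0. \<Psi> t > 0) \<and> antimono_on {0<..} \<Psi> \<and>
     (\<forall>t>0. \<Psi> differentiable (at t)) \<and> continuous_on {0<..} (deriv \<Psi>)"

text \<open>
  The relation ``the growth envelope of \<open>X\<close> is \<open>(\<Psi>, u)\<close>''. The index \<open>u\<close> is required to be the infimum for every
  sufficiently small \<open>\<epsilon>\<close>, the same \<open>\<epsilon>\<close> being used for all exponents \<open>v\<close>.
\<close>

definition has_growth_envelope ::
  "'a measure \<Rightarrow> ('a \<Rightarrow> real) set \<Rightarrow> (('a \<Rightarrow> real) \<Rightarrow> ennreal) \<Rightarrow> (real \<Rightarrow> real) \<Rightarrow> ennreal \<Rightarrow> bool" where
  "has_growth_envelope M X N \<Psi> u \<longleftrightarrow>
     envelope_gauge \<Psi> \<and> 0 < u \<and>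
     (\<exists>\<epsilon>>0. \<exists>A>0. \<exists>B>0. \<forall>t. 0 < t \<and> t < \<epsilon> \<longrightarrow>
        ennreal (A * \<Psi> t) \<le> growth_envelope_fun M X N t \<and>
        growth_envelope_fun M X N t \<le> ennreal (B * \<Psi> t)) \<and>
     (\<exists>\<epsilon>\<^sub>0>0. \<forall>\<epsilon>. 0 < \<epsilon> \<and> \<epsilon> < \<epsilon>\<^sub>0 \<longrightarrow>
        u = Inf {v. 0 < v \<and> (\<exists>c>0. \<forall>f\<in>X. envelope_integral M \<Psi> v \<epsilon> f \<le> ennreal c * N f)})"

end

theory Submission
  imports Defs "HOL-Real_Asymp.Real_Asymp"
begin

text \<open>
  Let \<open>m = min p\<^sub>i\<close>, attained at \<open>j\<close>. Since \<open>\<Omega>\<close> has finite measure, Hoelder's inequality in each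
  variable gives \<open>\<parallel>\<chi>\<^sub>A\<parallel>\<^sub>p \<ge> c \<mu>(A)^(1/m)\<close>, so that the mixed Lorentz space embeds into the classical
  \<open>L\<^sub>m\<^sub>,\<^sub>q\<close>; this yields the upper bound of the envelope and, by Tonelli, the integral estimate for
  \<open>v = q\<close>. The estimate is sharp on cylinders \<open>{x. x\<^sub>j \<in> E}\<close>, for which \<open>\<parallel>\<chi>\<parallel>\<^sub>p = C |E|^(1/m)\<close>. With
  \<open>\<rho>(y) = |\<Omega>\<^sub>j \<inter> (-\<infinity>, y]|\<close>, indicators of \<open>{\<rho>(x\<^sub>j) < s}\<close> give the lower bound of the envelope, and
  \<open>max(\<rho>(x\<^sub>j), R^(-m))^(-1/m)\<close>, as \<open>R \<rightarrow> \<infinity>\<close>, excludes \<open>v < q\<close>: its quasi-norm grows like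
  \<open>(ln R)^(1/q)\<close> and the envelope integral like \<open>(ln R)^(1/v)\<close>.
\<close>

subsection \<open>Powers and quasi-norms\<close>

text \<open>The obstacle is measurability. The lower bound therefore never integrates the norm
  exactly. A Borel function h with h^(1/m) below the integrand is carried through the coordinates,
  which only uses that \<open>nn_integral\<close> is monotone on all functions and that every
  function lies almost everywhere below its \<open>esssup\<close>. One exponent m serves all
  coordinates because on a finite measure space the L_p quasi-norm controls the L_m quasi-norm for m
  <= p. The function \<open>\<rho>\<close> replaces them: its sublevel sets are nested and take
  every measure up to that of the side. Once the set function A -> norm of the indicator of A is
  bounded below in general and known on these sublevel sets, the rest is analysis in one
  variable.\<close>

lemma enn_powr_ennreal: "0 \<le> x \<Longrightarrow> enn_powr (ennreal x) r = ennreal (x powr r)"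
  by (simp add: enn_powr_def)

lemma enn_powr_top [simp]: "enn_powr top r = top"
  by (simp add: enn_powr_def)

lemma enn_powr_0 [simp]: "enn_powr 0 r = 0"
  by (simp add: enn_powr_def)

lemma enn_powr_1 [simp]: "enn_powr x 1 = x"
  by (cases x) (auto simp: enn_powr_ennreal)

lemma enn_powr_one [simp]: "enn_powr 1 r = 1"
  using enn_powr_ennreal[of 1 r] by simp

lemma enn_powr_eq_0_iff [simp]: "enn_powr x r = 0 \<longleftrightarrow> x = 0"
  by (cases x) (auto simp: enn_powr_ennreal ennreal_eq_0_iff)

lemma enn_powr_eq_top_iff [simp]: "enn_powr x r = top \<longleftrightarrow> x = top"
  by (simp add: enn_powr_def)

lemma enn_powr_mono: "x \<le> y \<Longrightarrow> 0 \<le> r \<Longrightarrow> enn_powr x r \<le> enn_powr y r"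
  by (cases x; cases y) (auto simp: enn_powr_ennreal top_unique intro!: ennreal_leI powr_mono2)

text \<open>Exact also for the product of 0 and top, because \<open>enn_powr\<close> fixes 0 and top
  for every exponent.\<close>

lemma enn_powr_mult: "enn_powr (x * y) r = enn_powr x r * enn_powr y r"
proof (cases "x = top \<or> y = top")
  case True
  then show ?thesis
    by (cases "x = 0 \<or> y = 0") (auto simp: ennreal_mult_top ennreal_top_mult)
next
  case False
  then show ?thesis
    by (cases x; cases y) (auto simp: enn_powr_ennreal powr_mult simp flip: ennreal_mult)
qed

lemma enn_powr_enn_powr: "enn_powr (enn_powr x r) s = enn_powr x (r * s)"
  by (cases x) (auto simp: enn_powr_ennreal powr_powr)

lemma borel_measurable_enn_powr [measurable (raw)]:
  "f \<in> borel_measurable M \<Longrightarrow> (\<lambda>x. enn_powr (f x) r) \<in> borel_measurable M"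
  by (rule measurable_compose[of f M borel "\<lambda>y. enn_powr y r" borel])
     (auto simp: enn_powr_def intro!: measurable_If)

text \<open>
  Splitting at the level \<open>a\<close>, to be optimised over \<open>a\<close>, gives Hoelder's inequality up to a constant.
\<close>

lemma nn_integral_le_powr_integral:
  fixes h :: "'a \<Rightarrow> ennreal"
  assumes h [measurable]: "h \<in> borel_measurable M" and r: "1 \<le> r" and a: "0 < a"
  shows "(\<integral>\<^sup>+x. h x \<partial>M) \<le> ennreal a * emeasure M (space M)
           + ennreal (a powr (1 - r)) * (\<integral>\<^sup>+x. enn_powr (h x) r \<partial>M)"
proof -
  have "h x \<le> ennreal a + ennreal (a powr (1 - r)) * enn_powr (h x) r" for x
  proof (cases "h x")
    case (real y)
    show ?thesis
    proof (cases "y \<le> a")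
      case True
      then show ?thesis using real a by (simp add: add_increasing2)
    next
      case False
      have "y = y powr (1 - r) * y powr r" using False a by (simp flip: powr_add)
      also have "\<dots> \<le> a powr (1 - r) * y powr r"
        using False a r by (intro mult_right_mono powr_mono2') auto
      finally have "ennreal y \<le> ennreal (a powr (1 - r)) * ennreal (y powr r)"
        by (simp flip: ennreal_mult)
      then show ?thesis using real by (simp add: enn_powr_ennreal add_increasing)
    qed
  qed (use a in \<open>auto simp: ennreal_mult_top\<close>)
  then have "(\<integral>\<^sup>+x. h x \<partial>M)
      \<le> (\<integral>\<^sup>+x. ennreal a + ennreal (a powr (1 - r)) * enn_powr (h x) r \<partial>M)"
    by (intro nn_integral_mono) simp
  also have "\<dots> = ennreal a * emeasure M (space M)
      + ennreal (a powr (1 - r)) * (\<integral>\<^sup>+x. enn_powr (h x) r \<partial>M)"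
    by (simp add: nn_integral_add nn_integral_cmult)
  finally show ?thesis .
qed

text \<open>Splitting at about half the mean of h makes the first term at most half of the integral,
  so that it can be absorbed on the left. The price is a worse constant than in Jensen's inequality,
  which has C = mu^(1 - r).\<close>

lemma powr_nn_integral_le:
  assumes fin: "emeasure M (space M) < top" and r: "1 \<le> r"
  shows "\<exists>C>0. \<forall>h\<in>borel_measurable M.
           ennreal C * enn_powr (\<integral>\<^sup>+x. h x \<partial>M) r \<le> (\<integral>\<^sup>+x. enn_powr (h x) r \<partial>M)"
proof -
  obtain \<mu> where \<mu>: "emeasure M (space M) = ennreal \<mu>" "0 \<le> \<mu>"
    using fin by (cases "emeasure M (space M)") auto
  \<comment> \<open>\<open>b\<close> stands in for the total mass, so that dividing by it is safe
    even on a null space.\<close>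
  define b where "b = \<mu> + 1"
  have b: "0 < b" "\<mu> \<le> b" using \<mu> by (auto simp: b_def)
  \<comment> \<open>From (i / 2) a^(r - 1) with a = i / (2 b), which equals C i^r.\<close>
  define C where "C = (1 / 2) powr r * b powr (1 - r)"
  have "ennreal C * enn_powr (\<integral>\<^sup>+x. h x \<partial>M) r \<le> (\<integral>\<^sup>+x. enn_powr (h x) r \<partial>M)"
    if h: "h \<in> borel_measurable M" for h
  proof (cases "(\<integral>\<^sup>+x. enn_powr (h x) r \<partial>M)")
    case (real j)
    \<comment> \<open>The level 1 serves to show that the integral of h is finite, so that half of
      it can be subtracted below.\<close>
    have "(\<integral>\<^sup>+x. h x \<partial>M) \<le> ennreal 1 * ennreal \<mu> + ennreal (1 powr (1 - r)) * ennreal j"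
      using nn_integral_le_powr_integral[OF h r, of 1] real \<mu> by simp
    also have "\<dots> < top" by (simp add: ennreal_mult_less_top less_top[symmetric])
    finally obtain i where i: "(\<integral>\<^sup>+x. h x \<partial>M) = ennreal i" "0 \<le> i"
      by (cases "\<integral>\<^sup>+x. h x \<partial>M") auto
    show ?thesis
    proof (cases "i = 0")
      case False
      define a where "a = i / (2 * b)"
      have a: "0 < a" using False i b by (auto simp: a_def)
      have "ennreal i \<le> ennreal (a * \<mu> + a powr (1 - r) * j)"
        using nn_integral_le_powr_integral[OF h r a] real \<mu> i a by (simp add: ennreal_mult)
      then have "i \<le> a * \<mu> + a powr (1 - r) * j"
        using real \<mu> a by (subst (asm) ennreal_le_iff) auto
      also have "a * \<mu> \<le> a * b" using a b by simp
      also have "a * b = i / 2" using b by (simp add: a_def)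
      finally have "i / 2 \<le> a powr (1 - r) * j" by simp
      then have "i / 2 * a powr (r - 1) \<le> a powr (1 - r) * j * a powr (r - 1)"
        by (rule mult_right_mono) simp
      also have "\<dots> = j * (a powr (1 - r) * a powr (r - 1))" by simp
      also have "a powr (1 - r) * a powr (r - 1) = 1" using a by (simp flip: powr_add)
      finally have "i / 2 * a powr (r - 1) \<le> j" by simp
      moreover have "i / 2 * a powr (r - 1) = C * i powr r"
      proof -
        have "a powr (r - 1) = (i / 2) powr (r - 1) * b powr (1 - r)"
          using i b by (simp add: a_def powr_divide powr_mult divide_simps flip: powr_add)
        moreover have "i / 2 * (i / 2) powr (r - 1) = (i / 2) powr r"
          using i False by (simp add: powr_diff)
        ultimately have "i / 2 * a powr (r - 1) = (i / 2) powr r * b powr (1 - r)" by simp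
        then show ?thesis using i by (simp add: C_def powr_divide)
      qed
      ultimately show ?thesis using real i
        by (simp add: enn_powr_ennreal C_def flip: ennreal_mult)
    qed (use i in auto)
  qed auto
  moreover have "C > 0" using b by (simp add: C_def)
  ultimately show ?thesis by blast
qed

text \<open>
  The function \<open>G\<close> need not be measurable; this is what makes the estimate usable inside an iterated norm.
\<close>

lemma Lp_qnorm_ge_nn_integral:
  assumes fin: "emeasure M (space M) < top" and m: "0 < m" and mp: "ennreal m \<le> p"
  shows "\<exists>C>0. \<forall>h\<in>borel_measurable M. \<forall>G. (\<forall>x\<in>space M. enn_powr (h x) (1 / m) \<le> G x) \<longrightarrow>
           ennreal C * enn_powr (\<integral>\<^sup>+x. h x \<partial>M) (1 / m) \<le> Lp_qnorm M p G"
proof (cases "p = top")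
  case True
  obtain \<mu> where \<mu>: "emeasure M (space M) = ennreal \<mu>" "0 \<le> \<mu>"
    using fin by (cases "emeasure M (space M)") auto
  define C where "C = (\<mu> + 1) powr (- 1 / m)"
  have "ennreal C * enn_powr (\<integral>\<^sup>+x. h x \<partial>M) (1 / m) \<le> Lp_qnorm M p G"
    if h: "h \<in> borel_measurable M" and G: "\<forall>x\<in>space M. enn_powr (h x) (1 / m) \<le> G x" for h G
  proof -
    define z where "z = esssup M G"
    \<comment> \<open>The bound of G by its \<open>esssup\<close> holds almost everywhere for every
      function G.\<close>
    have "AE x in M. h x \<le> enn_powr z m"
      using esssup_AE[of G M] AE_space
    proof eventually_elim
      case (elim x)
      then have "enn_powr (h x) (1 / m) \<le> z" using G by (auto simp: z_def)
      then have "enn_powr (enn_powr (h x) (1 / m)) m \<le> enn_powr z m" using m by (intro enn_powr_mono) auto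
      then show ?case using m by (simp add: enn_powr_enn_powr)
    qed
    then have "(\<integral>\<^sup>+x. h x \<partial>M) \<le> (\<integral>\<^sup>+x. enn_powr z m \<partial>M)" by (rule nn_integral_mono_AE)
    also have "\<dots> \<le> enn_powr z m * ennreal (\<mu> + 1)"
      using \<mu> by (auto intro!: mult_left_mono ennreal_leI)
    finally have "enn_powr (\<integral>\<^sup>+x. h x \<partial>M) (1 / m) \<le> enn_powr (enn_powr z m * ennreal (\<mu> + 1)) (1 / m)"
      using m by (intro enn_powr_mono) auto
    also have "\<dots> = z * ennreal ((\<mu> + 1) powr (1 / m))"
      using m \<mu> by (simp add: enn_powr_mult enn_powr_enn_powr enn_powr_ennreal del: ennreal_plus)
    finally have "ennreal C * enn_powr (\<integral>\<^sup>+x. h x \<partial>M) (1 / m)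
        \<le> ennreal C * (z * ennreal ((\<mu> + 1) powr (1 / m)))" by (rule mult_left_mono) simp
    also have "\<dots> = z * ennreal (C * (\<mu> + 1) powr (1 / m))" by (simp add: C_def ennreal_mult mult_ac)
    also have "C * (\<mu> + 1) powr (1 / m) = 1" using \<mu> by (simp add: C_def flip: powr_add)
    finally show ?thesis using True by (simp add: Lp_qnorm_def z_def)
  qed
  moreover have "C > 0" using \<mu> by (simp add: C_def)
  ultimately show ?thesis by blast
next
  case False
  define P where "P = enn2real p"
  have p: "p = ennreal P" "0 \<le> P" using False by (auto simp: P_def less_top)
  have mP: "m \<le> P" using mp p m by simp
  \<comment> \<open>h^(P/m) is the P-th power of h^(1/m), which G dominates; so the power inequality
    is applied to h with exponent P / m.\<close>
  define r where "r = P / m"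
  have r: "1 \<le> r" using mP m by (simp add: r_def)
  obtain C where C: "C > 0" and CI: "\<And>h. h \<in> borel_measurable M \<Longrightarrow>
      ennreal C * enn_powr (\<integral>\<^sup>+x. h x \<partial>M) r \<le> (\<integral>\<^sup>+x. enn_powr (h x) r \<partial>M)"
    using powr_nn_integral_le[OF fin r] by blast
  have "ennreal (C powr (1 / P)) * enn_powr (\<integral>\<^sup>+x. h x \<partial>M) (1 / m) \<le> Lp_qnorm M p G"
    if h: "h \<in> borel_measurable M" and G: "\<forall>x\<in>space M. enn_powr (h x) (1 / m) \<le> G x" for h G
  proof -
    have "enn_powr (h x) r \<le> enn_powr (G x) P" if "x \<in> space M" for x
      using enn_powr_mono[OF G[rule_format, OF that], of P] p by (simp add: enn_powr_enn_powr r_def)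
    then have "(\<integral>\<^sup>+x. enn_powr (h x) r \<partial>M) \<le> (\<integral>\<^sup>+x. enn_powr (G x) P \<partial>M)"
      by (intro nn_integral_mono) auto
    with CI[OF h] have "ennreal C * enn_powr (\<integral>\<^sup>+x. h x \<partial>M) r \<le> (\<integral>\<^sup>+x. enn_powr (G x) P \<partial>M)"
      by (rule order_trans)
    then have "enn_powr (ennreal C * enn_powr (\<integral>\<^sup>+x. h x \<partial>M) r) (1 / P)
        \<le> enn_powr (\<integral>\<^sup>+x. enn_powr (G x) P \<partial>M) (1 / P)" using p by (intro enn_powr_mono) auto
    moreover have "r * (1 / P) = 1 / m" using mP m by (simp add: r_def)
    ultimately show ?thesis using C False
      by (simp add: enn_powr_mult enn_powr_enn_powr enn_powr_ennreal Lp_qnorm_def flip: P_def)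
  qed
  then show ?thesis using C by (intro exI[of _ "C powr (1 / P)"]) auto
qed

subsection \<open>Lower bounds for mixed norms of indicators\<close>

lemma product_sigma_finite_lborel: "product_sigma_finite (\<lambda>_. lborel :: real measure)"
  by (rule product_sigma_finite.intro) (rule lborel.sigma_finite_measure_axioms)

text \<open>The L_1 analogue of \<open>mixed_partial\<close>, taken over whole lines and with Borel
  measure, so that measurability and Tonelli's theorem are available at each stage.\<close>

primrec iterated_integral :: "nat \<Rightarrow> ((nat \<Rightarrow> real) \<Rightarrow> ennreal) \<Rightarrow> (nat \<Rightarrow> real) \<Rightarrow> ennreal" where
  "iterated_integral 0 h = h"
| "iterated_integral (Suc k) h = (\<lambda>x. \<integral>\<^sup>+s. iterated_integral k h (x(k := s)) \<partial>lborel)"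

lemma fun_upd_PiE_Suc: "x \<in> PiE {Suc k..<d} (\<lambda>_. UNIV) \<Longrightarrow> k < d \<Longrightarrow> x(k := s) \<in> PiE {k..<d} (\<lambda>_. UNIV)"
  by (auto simp: PiE_def extensional_def)

lemma borel_measurable_iterated_integral:
  assumes "k \<le> d" and h: "h \<in> borel_measurable (Pi\<^sub>M {0..<d} (\<lambda>_. lborel))"
  shows "iterated_integral k h \<in> borel_measurable (Pi\<^sub>M {k..<d} (\<lambda>_. lborel))"
  using \<open>k \<le> d\<close>
proof (induction k)
  case (Suc k)
  have "{k..<d} = insert k {Suc k..<d}" using Suc.prems by auto
  then have [measurable]: "iterated_integral k h \<in> borel_measurable (Pi\<^sub>M (insert k {Suc k..<d}) (\<lambda>_. lborel))"
    using Suc by simp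
  have "(\<lambda>(x, s). iterated_integral k h (x(k := s)))
      \<in> borel_measurable (Pi\<^sub>M {Suc k..<d} (\<lambda>_. lborel) \<Otimes>\<^sub>M lborel)"
    using measurable_compose[OF measurable_add_dim
        \<open>iterated_integral k h \<in> borel_measurable (Pi\<^sub>M (insert k {Suc k..<d}) (\<lambda>_. lborel))\<close>]
    by (simp add: case_prod_beta')
  then show ?case by (simp add: lborel.borel_measurable_nn_integral)
qed (use h in simp)

lemma nn_integral_iterated_integral:
  assumes "k \<le> d" and h: "h \<in> borel_measurable (Pi\<^sub>M {0..<d} (\<lambda>_. lborel))"
  shows "(\<integral>\<^sup>+x. iterated_integral k h x \<partial>Pi\<^sub>M {k..<d} (\<lambda>_. lborel)) = (\<integral>\<^sup>+x. h x \<partial>Pi\<^sub>M {0..<d} (\<lambda>_. lborel))"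
  using \<open>k \<le> d\<close>
proof (induction k)
  case (Suc k)
  have eq: "{k..<d} = insert k {Suc k..<d}" using Suc.prems by auto
  have "iterated_integral k h \<in> borel_measurable (Pi\<^sub>M {k..<d} (\<lambda>_. lborel))"
    using borel_measurable_iterated_integral[OF _ h, of k] Suc.prems by simp
  then have "(\<integral>\<^sup>+x. iterated_integral k h x \<partial>Pi\<^sub>M {k..<d} (\<lambda>_. lborel))
      = (\<integral>\<^sup>+x. iterated_integral (Suc k) h x \<partial>Pi\<^sub>M {Suc k..<d} (\<lambda>_. lborel))"
    unfolding eq by (subst product_sigma_finite.product_nn_integral_insert[OF product_sigma_finite_lborel]) auto
  then show ?case using Suc by simp
qed simp

text \<open>The product measure over the empty index set is the point mass at the everywhere
  undefined function, which is also the base point in \<open>mixed_norm\<close>.\<close>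

lemma iterated_integral_eq_nn_integral:
  assumes h: "h \<in> borel_measurable (Pi\<^sub>M {0..<d} (\<lambda>_. lborel))"
  shows "iterated_integral d h (\<lambda>_. undefined) = (\<integral>\<^sup>+x. h x \<partial>Pi\<^sub>M {0..<d} (\<lambda>_. lborel))"
  using nn_integral_iterated_integral[OF order_refl h] by (simp add: product_sigma_finite.nn_integral_empty[OF product_sigma_finite_lborel])

text \<open>Vanishing off the box lets an integral over the whole line be read as one over
  \<open>\<Omega> k\<close>, where the norm in coordinate k is taken.\<close>

lemma iterated_integral_eq_0:
  assumes "k \<le> d" and h: "\<And>x. x \<in> PiE {0..<d} (\<lambda>_. UNIV) \<Longrightarrow> x \<notin> PiE {0..<d} \<Omega> \<Longrightarrow> h x = 0"
    and "x \<in> PiE {k..<d} (\<lambda>_. UNIV)" "x \<notin> PiE {k..<d} \<Omega>"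
  shows "iterated_integral k h x = 0"
  using assms(1,3,4)
proof (induction k arbitrary: x)
  case (Suc k)
  have "x(k := s) \<notin> PiE {k..<d} \<Omega>" for s
  proof
    assume "x(k := s) \<in> PiE {k..<d} \<Omega>"
    then have "x i \<in> \<Omega> i" if "i \<in> {Suc k..<d}" for i
      using that PiE_mem[of "x(k := s)" "{k..<d}" \<Omega> i] by auto
    then show False using Suc.prems by (auto simp: PiE_def)
  qed
  then show ?case
    using Suc.IH fun_upd_PiE_Suc[OF Suc.prems(2)] Suc.prems(1) by simp
qed (auto intro!: h)

text \<open>The bound at stage k is the pointwise premise of the one-variable estimate in coordinate
  k, which returns a bound of the same shape with h integrated once more; the constants multiply. C
  is quantified before h and F, so it depends only on the sides, the exponents and k.\<close>

lemma mixed_partial_ge_iterated_integral: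
  fixes p :: "nat \<Rightarrow> ennreal"
  assumes \<Omega>: "\<And>i. i < d \<Longrightarrow> \<Omega> i \<in> sets lebesgue" "\<And>i. i < d \<Longrightarrow> emeasure lebesgue (\<Omega> i) < top"
    and m: "0 < m" "\<And>i. i < d \<Longrightarrow> ennreal m \<le> p i"
    and k: "k \<le> d"
  shows "\<exists>C>0. \<forall>h F. h \<in> borel_measurable (Pi\<^sub>M {0..<d} (\<lambda>_. lborel)) \<longrightarrow>
           (\<forall>x. x \<in> PiE {0..<d} (\<lambda>_. UNIV) \<longrightarrow> x \<notin> PiE {0..<d} \<Omega> \<longrightarrow> h x = 0) \<longrightarrow>
           (\<forall>x. enn_powr (h x) (1 / m) \<le> F x) \<longrightarrow>
           (\<forall>x\<in>PiE {k..<d} (\<lambda>_. UNIV).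
              ennreal C * enn_powr (iterated_integral k h x) (1 / m) \<le> mixed_partial \<Omega> p k F x)"
  using k
proof (induction k)
  case 0
  then show ?case by (intro exI[of _ 1]) auto
next
  case (Suc k)
  then obtain C where C: "0 < C" and CI: "\<And>h F x. h \<in> borel_measurable (Pi\<^sub>M {0..<d} (\<lambda>_. lborel)) \<Longrightarrow>
      (\<And>x. x \<in> PiE {0..<d} (\<lambda>_. UNIV) \<Longrightarrow> x \<notin> PiE {0..<d} \<Omega> \<Longrightarrow> h x = 0) \<Longrightarrow>
      (\<And>x. enn_powr (h x) (1 / m) \<le> F x) \<Longrightarrow> x \<in> PiE {k..<d} (\<lambda>_. UNIV) \<Longrightarrow>
      ennreal C * enn_powr (iterated_integral k h x) (1 / m) \<le> mixed_partial \<Omega> p k F x"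
    by auto
  have k: "k < d" using Suc.prems by simp
  have "emeasure (lebesgue_on (\<Omega> k)) (space (lebesgue_on (\<Omega> k))) < top"
    using \<Omega>[OF k] by (simp add: emeasure_restrict_space space_restrict_space)
  from Lp_qnorm_ge_nn_integral[OF this m(1) m(2)[OF k]]
  obtain C' where C': "0 < C'" and CI': "\<And>h G. h \<in> borel_measurable (lebesgue_on (\<Omega> k)) \<Longrightarrow>
      (\<And>x. enn_powr (h x) (1 / m) \<le> G x) \<Longrightarrow>
      ennreal C' * enn_powr (\<integral>\<^sup>+x. h x \<partial>lebesgue_on (\<Omega> k)) (1 / m) \<le> Lp_qnorm (lebesgue_on (\<Omega> k)) (p k) G"
    by blast
  have "ennreal (C' * C) * enn_powr (iterated_integral (Suc k) h x) (1 / m) \<le> mixed_partial \<Omega> p (Suc k) F x"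
    if h: "h \<in> borel_measurable (Pi\<^sub>M {0..<d} (\<lambda>_. lborel))"
      and h0: "\<And>x. x \<in> PiE {0..<d} (\<lambda>_. UNIV) \<Longrightarrow> x \<notin> PiE {0..<d} \<Omega> \<Longrightarrow> h x = 0"
      and hF: "\<And>x. enn_powr (h x) (1 / m) \<le> F x"
      and x: "x \<in> PiE {Suc k..<d} (\<lambda>_. UNIV)" for h F x
  proof -
    define H where "H = (\<lambda>s. iterated_integral k h (x(k := s)))"
    have eq: "{k..<d} = insert k {Suc k..<d}" using k by auto
    have I: "iterated_integral k h \<in> borel_measurable (Pi\<^sub>M (insert k {Suc k..<d}) (\<lambda>_. lborel))"
      using borel_measurable_iterated_integral[OF _ h, of k] k eq by simp
    have "(\<lambda>s. x(k := s)) \<in> measurable lborel (Pi\<^sub>M (insert k {Suc k..<d}) (\<lambda>_. lborel))"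
      by (rule measurable_fun_upd[where J = "{Suc k..<d}"]) (use x in \<open>auto simp: space_PiM\<close>)
    from measurable_compose[OF this I] have H [measurable]: "H \<in> borel_measurable lborel"
      by (simp add: H_def)
    then have Hc: "H \<in> borel_measurable lebesgue" by (rule measurable_completion)
    have H0: "H s = 0" if "s \<notin> \<Omega> k" for s
      unfolding H_def
    proof (rule iterated_integral_eq_0[OF _ h0])
      show "x(k := s) \<in> PiE {k..<d} (\<lambda>_. UNIV)" by (rule fun_upd_PiE_Suc[OF x k])
      show "x(k := s) \<notin> PiE {k..<d} \<Omega>"
        using that k PiE_mem[of "x(k := s)" "{k..<d}" \<Omega> k] by auto
    qed (use k in auto)
    have "(\<integral>\<^sup>+s. H s \<partial>lebesgue_on (\<Omega> k)) = (\<integral>\<^sup>+s. H s * indicator (\<Omega> k) s \<partial>lebesgue)"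
      using \<Omega>[OF k] by (subst nn_integral_restrict_space) auto
    also have "\<dots> = (\<integral>\<^sup>+s. H s \<partial>lebesgue)"
      using H0 by (intro nn_integral_cong) (auto simp: indicator_def)
    also have "\<dots> = (\<integral>\<^sup>+s. H s \<partial>lborel)" by (rule nn_integral_completion)
    finally have int: "(\<integral>\<^sup>+s. H s \<partial>lebesgue_on (\<Omega> k)) = iterated_integral (Suc k) h x" by (simp add: H_def)
    have Hr [measurable]: "H \<in> borel_measurable (lebesgue_on (\<Omega> k))"
      using Hc by (rule measurable_restrict_space1)
    \<comment> \<open>The constant of stage k goes inside the integral as C^m, so that the power 1/m
      gives C back.\<close>
    have "ennreal C' * enn_powr (\<integral>\<^sup>+s. ennreal (C powr m) * H s \<partial>lebesgue_on (\<Omega> k)) (1 / m)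
        \<le> Lp_qnorm (lebesgue_on (\<Omega> k)) (p k) (\<lambda>s. mixed_partial \<Omega> p k F (x(k := s)))"
    proof (rule CI')
      fix s
      show "enn_powr (ennreal (C powr m) * H s) (1 / m) \<le> mixed_partial \<Omega> p k F (x(k := s))"
        using CI[OF h h0 hF fun_upd_PiE_Suc[OF x k, of s]] C m
        by (simp add: H_def enn_powr_mult enn_powr_ennreal powr_powr)
    qed measurable
    then show ?thesis using C m C'
      by (simp add: nn_integral_cmult int enn_powr_mult enn_powr_ennreal powr_powr ennreal_mult mult.assoc
          del: iterated_integral.simps)
  qed
  note step = this
  show ?case
  proof (intro exI[of _ "C' * C"] conjI allI impI ballI)
    show "0 < C' * C" using C C' by simp
  qed (rule step; simp)
qed

section \<open>Boxes in the completed product measure\<close>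

lemma space_box_measure [simp]: "space (box_measure d \<Omega>) = box_set d \<Omega>"
  by (auto simp: box_measure_def space_restrict_space space_PiM box_set_def)

lemma PiE_null_sets:
  assumes "i < d" "N \<in> null_sets (lborel :: real measure)"
  shows "{x \<in> PiE {..<d} (\<lambda>_. UNIV). x i \<in> N} \<in> null_sets (Pi\<^sub>M {..<d} (\<lambda>_::nat. lborel :: real measure))"
proof -
  let ?A = "\<lambda>j. if j = i then N else UNIV :: real set"
  have eq: "{x \<in> PiE {..<d} (\<lambda>_. UNIV). x i \<in> N} = PiE {..<d} ?A"
  proof (intro equalityI subsetI)
    fix x assume x: "x \<in> PiE {..<d} ?A"
    have "x i \<in> N" using PiE_mem[OF x, of i] \<open>i < d\<close> by simp
    moreover have "PiE {..<d} ?A \<subseteq> PiE {..<d} (\<lambda>_. UNIV)" by (rule PiE_mono) simp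
    ultimately show "x \<in> {x \<in> PiE {..<d} (\<lambda>_. UNIV). x i \<in> N}" using x by blast
  next
    fix x assume x: "x \<in> {x \<in> PiE {..<d} (\<lambda>_. UNIV). x i \<in> N}"
    then have "x \<in> PiE {..<d} (\<lambda>_. UNIV)" by simp
    from PiE_arb[OF this] x show "x \<in> PiE {..<d} ?A" by (intro PiE_I) simp_all
  qed
  have A: "?A j \<in> sets lborel" for j using assms by auto
  have "emeasure (Pi\<^sub>M {..<d} (\<lambda>_. lborel)) (PiE {..<d} ?A) = (\<Prod>j<d. emeasure lborel (?A j))"
    using A by (intro product_sigma_finite.emeasure_PiM[OF product_sigma_finite_lborel]) auto
  \<comment> \<open>Any other factors are infinite, but 0 times top is 0.\<close>
  also have "\<dots> = 0" using assms by (intro prod_zero) auto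
  finally show ?thesis unfolding eq using A by (intro null_setsI sets_PiM_I_finite) auto
qed

text \<open>Each side is its Borel main part together with a subset of a Borel null set. The box
  thus differs from the Borel box of the main parts only at points with some coordinate in a null
  set, and such slabs are null in the product.\<close>

lemma PiE_sets_completion:
  assumes E: "\<And>i. i < d \<Longrightarrow> E i \<in> sets lebesgue"
  shows "PiE {..<d} E \<in> sets (completion (Pi\<^sub>M {..<d} (\<lambda>_::nat. lborel :: real measure)))" (is ?S)
    and "emeasure (completion (Pi\<^sub>M {..<d} (\<lambda>_::nat. lborel :: real measure))) (PiE {..<d} E) = (\<Prod>i<d. emeasure lebesgue (E i))" (is ?E)
proof -
  let ?P = "Pi\<^sub>M {..<d} (\<lambda>_::nat. lborel :: real measure)"
  let ?B = "PiE {..<d} (\<lambda>i. main_part lborel (E i))"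
  have Bi: "main_part lborel (E i) \<in> sets lborel" if "i < d" for i
    using main_part_sets[OF E[OF that]] .
  then have B: "?B \<in> sets ?P" by (intro sets_PiM_I_finite) auto
  have "\<exists>N. N \<in> null_sets lborel \<and> null_part lborel (E i) \<subseteq> N" if "i < d" for i
    using null_part[OF E[OF that]] by blast
  then obtain N where N: "\<And>i. i < d \<Longrightarrow> N i \<in> null_sets lborel" "\<And>i. i < d \<Longrightarrow> null_part lborel (E i) \<subseteq> N i"
    by metis
  let ?N = "\<Union>i<d. {x \<in> PiE {..<d} (\<lambda>_. UNIV). x i \<in> N i}"
  have N0: "?N \<in> null_sets ?P" using N by (intro null_sets_UN' PiE_null_sets) auto
  have main: "main_part lborel (E i) \<subseteq> E i" if "i < d" for i
    using main_part_null_part_Un[OF E[OF that]] by blast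
  have E_split: "E i \<subseteq> main_part lborel (E i) \<union> N i" if "i < d" for i
    using main_part_null_part_Un[OF E[OF that]] N(2)[OF that] by blast
  have sub: "?B \<subseteq> PiE {..<d} E" using main by (intro PiE_mono) auto
  have sub': "PiE {..<d} E - ?B \<subseteq> ?N"
    using E_split by (auto simp: PiE_iff) blast
  have null: "PiE {..<d} E - ?B \<in> null_sets (completion ?P)"
    using sub' null_sets_completionI[OF N0] by (rule null_sets_completion_subset) 
  have eq: "PiE {..<d} E = ?B \<union> (PiE {..<d} E - ?B)" using sub by blast
  have BC: "?B \<in> sets (completion ?P)" using B by (rule sets_completionI_sets)
  show ?S by (subst eq, rule sets.Un[OF BC]) (use null in blast)
  have "emeasure (completion ?P) (PiE {..<d} E) = emeasure (completion ?P) ?B"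
    by (subst eq, rule emeasure_Un_null_set[OF BC null])
  also have "\<dots> = emeasure ?P ?B" using B by simp
  also have "\<dots> = (\<Prod>i<d. emeasure lborel (main_part lborel (E i)))"
    using Bi by (intro product_sigma_finite.emeasure_PiM[OF product_sigma_finite_lborel]) auto
  also have "\<dots> = (\<Prod>i<d. emeasure lebesgue (E i))"
    using E by (intro prod.cong) auto
  finally show ?E .
qed

lemma box_set_sets_completion:
  assumes "\<And>i. i < d \<Longrightarrow> \<Omega> i \<in> sets lebesgue"
  shows "box_set d \<Omega> \<in> sets (completion (Pi\<^sub>M {..<d} (\<lambda>_. lborel)))"
  unfolding box_set_def using assms by (rule PiE_sets_completion)

lemma sets_box_measure_iff:
  assumes "\<And>i. i < d \<Longrightarrow> \<Omega> i \<in> sets lebesgue"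
  shows "A \<in> sets (box_measure d \<Omega>) \<longleftrightarrow>
      A \<subseteq> box_set d \<Omega> \<and> A \<in> sets (completion (Pi\<^sub>M {..<d} (\<lambda>_. lborel)))"
  unfolding box_measure_def
  by (subst sets_restrict_space_iff) (use box_set_sets_completion[OF assms] in auto)

lemma emeasure_box_measure:
  assumes "\<And>i. i < d \<Longrightarrow> \<Omega> i \<in> sets lebesgue" "A \<subseteq> box_set d \<Omega>"
  shows "emeasure (box_measure d \<Omega>) A = emeasure (completion (Pi\<^sub>M {..<d} (\<lambda>_. lborel))) A"
  unfolding box_measure_def
  by (rule emeasure_restrict_space) (use box_set_sets_completion[OF assms(1)] assms(2) in auto)

lemma mixed_norm_indicator_ge:
  fixes p :: "nat \<Rightarrow> ennreal"
  assumes \<Omega>: "\<And>i. i < d \<Longrightarrow> \<Omega> i \<in> sets lebesgue" "\<And>i. i < d \<Longrightarrow> emeasure lebesgue (\<Omega> i) < top"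
    and m: "0 < m" "\<And>i. i < d \<Longrightarrow> ennreal m \<le> p i"
  shows "\<exists>C>0. \<forall>A\<in>sets (box_measure d \<Omega>).
           ennreal C * enn_powr (emeasure (box_measure d \<Omega>) A) (1 / m) \<le> mixed_norm d \<Omega> p (indicat_real A)"
proof -
  let ?P = "Pi\<^sub>M {0..<d} (\<lambda>_::nat. lborel :: real measure)"
  obtain C where C: "0 < C" and CI: "\<And>h F x. h \<in> borel_measurable ?P \<Longrightarrow>
      (\<And>x. x \<in> PiE {0..<d} (\<lambda>_. UNIV) \<Longrightarrow> x \<notin> PiE {0..<d} \<Omega> \<Longrightarrow> h x = 0) \<Longrightarrow>
      (\<And>x. enn_powr (h x) (1 / m) \<le> F x) \<Longrightarrow> x \<in> PiE {d..<d} (\<lambda>_. UNIV) \<Longrightarrow>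
      ennreal C * enn_powr (iterated_integral d h x) (1 / m) \<le> mixed_partial \<Omega> p d F x"
    by (rule exE[OF mixed_partial_ge_iterated_integral[of d \<Omega> m p d]], (use \<Omega> m in auto)[5],
        elim conjE, rule that, assumption, blast)
  have "ennreal C * enn_powr (emeasure (box_measure d \<Omega>) A) (1 / m) \<le> mixed_norm d \<Omega> p (indicat_real A)"
    if "A \<in> sets (box_measure d \<Omega>)" for A
  proof -
    have A: "A \<subseteq> box_set d \<Omega>" "A \<in> sets (completion ?P)"
      using that sets_box_measure_iff[of d \<Omega> A] \<Omega>(1) by (auto simp: lessThan_atLeast0)
    \<comment> \<open>A Borel subset of the same measure: its indicator is admissible as h, while
      the indicator of A itself, whatever its sections, plays the part of F.\<close>
    define B where "B = main_part ?P A"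
    have B: "B \<in> sets ?P" "B \<subseteq> A"
      unfolding B_def using A(2) main_part_null_part_Un[OF A(2)] by (simp, blast)
    have [measurable]: "indicator B \<in> borel_measurable ?P" using B by measurable
    have "ennreal C * enn_powr (iterated_integral d (indicator B) (\<lambda>_. undefined)) (1 / m)
        \<le> mixed_partial \<Omega> p d (\<lambda>x. ennreal \<bar>indicat_real A x\<bar>) (\<lambda>_. undefined)"
    proof (rule CI)
      show "indicator B x = (0 :: ennreal)" if "x \<notin> PiE {0..<d} \<Omega>" for x
      proof -
        have "B \<subseteq> PiE {0..<d} \<Omega>"
          using subset_trans[OF B(2) A(1)] unfolding box_set_def lessThan_atLeast0 .
        from contra_subsetD[OF this that] show ?thesis by simp
      qed
      show "enn_powr (indicator B x) (1 / m) \<le> ennreal \<bar>indicat_real A x\<bar>" for x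
        using subsetD[OF B(2), of x] by (cases "x \<in> B") simp_all
      show "(\<lambda>_. undefined) \<in> PiE {d..<d} (\<lambda>_. UNIV :: real set)" by simp
      show "indicator B \<in> borel_measurable ?P" by fact
    qed
    also have "iterated_integral d (indicator B) (\<lambda>_. undefined) = emeasure ?P B"
      using B by (simp add: iterated_integral_eq_nn_integral)
    also have "\<dots> = emeasure (box_measure d \<Omega>) A"
      using A \<Omega>(1) by (simp add: emeasure_box_measure emeasure_completion B_def lessThan_atLeast0)
    finally show ?thesis by (simp add: mixed_norm_def)
  qed
  with C show ?thesis by blast
qed

subsection \<open>Cylinder sets\<close>

text \<open>For p = top the essential supremum forgets the size of E as long as E is not null. Small
  norms must therefore come from a side with finite exponent.\<close>

lemma Lp_qnorm_cmult_indicator: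
  assumes S: "S \<in> sets lebesgue" and E: "E \<in> sets lebesgue" "E \<subseteq> S"
    and p: "0 < p" "p = top \<Longrightarrow> 0 < emeasure lebesgue E"
  shows "Lp_qnorm (lebesgue_on S) p (\<lambda>s. a * indicator E s)
      = a * (if p = top then 1 else enn_powr (emeasure lebesgue E) (1 / enn2real p))"
proof -
  have Er: "E \<in> sets (lebesgue_on S)" using S E by (simp add: sets_restrict_space_iff)
  have mE: "emeasure (lebesgue_on S) E = emeasure lebesgue E"
    using S E by (simp add: emeasure_restrict_space)
  have meas: "(\<lambda>s. a * indicator E s) \<in> borel_measurable (lebesgue_on S)"
    using Er by measurable
  show ?thesis
  proof (cases "p = top")
    case True
    have "Inf {z. AE x in lebesgue_on S. a * indicator E x \<le> z} = a"
    proof (intro antisym Inf_lower Inf_greatest)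
      show "a \<in> {z. AE x in lebesgue_on S. a * indicator E x \<le> z}"
        by (auto simp: indicator_def)
    next
      fix z assume "z \<in> {z. AE x in lebesgue_on S. a * indicator E x \<le> z}"
      then have AE: "AE x in lebesgue_on S. a * indicator E x \<le> z" by simp
      show "a \<le> z"
      proof (rule ccontr)
        assume n: "\<not> a \<le> z"
        from AE have "AE x in lebesgue_on S. x \<notin> E"
          by eventually_elim (use n in \<open>auto simp: indicator_def\<close>)
        then have "emeasure (lebesgue_on S) E = 0"
          using Er sets.sets_into_space[OF Er] by (subst (asm) AE_iff_measurable[OF Er]) auto
        then show False using mE p True by simp
      qed
    qed
    then show ?thesis using True by (simp add: Lp_qnorm_def esssup_eq_AE[OF meas])
  next
    case False
    define P where "P = enn2real p"
    have P: "0 < P" using p False by (simp add: P_def enn2real_positive_iff less_top)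
    have "(\<integral>\<^sup>+s. enn_powr (a * indicator E s) P \<partial>lebesgue_on S)
        = (\<integral>\<^sup>+s. enn_powr a P * indicator E s \<partial>lebesgue_on S)"
      by (intro nn_integral_cong) (simp split: split_indicator)
    also have "\<dots> = enn_powr a P * emeasure lebesgue E"
      using Er by (simp add: nn_integral_cmult_indicator mE)
    finally show ?thesis using False P
      by (simp add: Lp_qnorm_def enn_powr_mult enn_powr_enn_powr flip: P_def)
  qed
qed

lemma fun_upd_in_PiE_Suc_iff:
  assumes "x \<in> PiE {Suc k..<d} (\<lambda>_. UNIV)" "k < d"
  shows "x(k := s) \<in> PiE {k..<d} E \<longleftrightarrow> s \<in> E k \<and> x \<in> PiE {Suc k..<d} E"
proof -
  have "{k..<d} = insert k {Suc k..<d}" using assms by auto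
  then show ?thesis using assms by (simp add: PiE_iff extensional_def)
qed

text \<open>The indicator of a box is a product over the coordinates, so each stage takes the norm
  of one factor while everything else acts as the constant \<open>a\<close> of
  \<open>Lp_qnorm_cmult_indicator\<close>.\<close>

lemma mixed_partial_indicator_PiE:
  fixes p :: "nat \<Rightarrow> ennreal"
  assumes \<Omega>: "\<And>i. i < d \<Longrightarrow> \<Omega> i \<in> sets lebesgue"
    and E: "\<And>i. i < d \<Longrightarrow> E i \<in> sets lebesgue" "\<And>i. i < d \<Longrightarrow> E i \<subseteq> \<Omega> i"
    and p: "\<And>i. i < d \<Longrightarrow> 0 < p i" "\<And>i. i < d \<Longrightarrow> p i = top \<Longrightarrow> 0 < emeasure lebesgue (E i)"
    and "k \<le> d" "x \<in> PiE {k..<d} (\<lambda>_. UNIV)"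
  shows "mixed_partial \<Omega> p k (\<lambda>x. ennreal \<bar>indicat_real (PiE {..<d} E) x\<bar>) x
      = (\<Prod>i<k. if p i = top then 1 else enn_powr (emeasure lebesgue (E i)) (1 / enn2real (p i)))
          * indicator (PiE {k..<d} E) x"
  using assms(6,7)
proof (induction k arbitrary: x)
  case 0
  then show ?case by (simp add: lessThan_atLeast0 split: split_indicator)
next
  case (Suc k)
  let ?c = "\<lambda>i. if p i = top then 1 else enn_powr (emeasure lebesgue (E i)) (1 / enn2real (p i))"
  have k: "k < d" using Suc.prems by simp
  have "mixed_partial \<Omega> p k (\<lambda>x. ennreal \<bar>indicat_real (PiE {..<d} E) x\<bar>) (x(k := s))
      = ((\<Prod>i<k. ?c i) * indicator (PiE {Suc k..<d} E) x) * indicator (E k) s" for s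
  proof -
    have "indicator (PiE {k..<d} E) (x(k := s)) = indicator (PiE {Suc k..<d} E) x * (indicator (E k) s :: ennreal)"
      by (auto simp: fun_upd_in_PiE_Suc_iff[OF Suc.prems(2) k] split: split_indicator)
    then show ?thesis
      using Suc.IH[OF _ fun_upd_PiE_Suc[OF Suc.prems(2) k, of s]] k by (simp only: mult.assoc)
  qed
  then show ?case
    using Lp_qnorm_cmult_indicator[OF \<Omega>[OF k] E(1)[OF k] E(2)[OF k] p(1)[OF k] p(2)[OF k],
        of "(\<Prod>i<k. ?c i) * indicator (PiE {Suc k..<d} E) x"]
    by (simp add: mult_ac)
qed

lemma mixed_norm_indicator_PiE:
  fixes p :: "nat \<Rightarrow> ennreal"
  assumes "\<And>i. i < d \<Longrightarrow> \<Omega> i \<in> sets lebesgue"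
    and "\<And>i. i < d \<Longrightarrow> E i \<in> sets lebesgue" "\<And>i. i < d \<Longrightarrow> E i \<subseteq> \<Omega> i"
    and "\<And>i. i < d \<Longrightarrow> 0 < p i" "\<And>i. i < d \<Longrightarrow> p i = top \<Longrightarrow> 0 < emeasure lebesgue (E i)"
  shows "mixed_norm d \<Omega> p (indicat_real (PiE {..<d} E))
      = (\<Prod>i<d. if p i = top then 1 else enn_powr (emeasure lebesgue (E i)) (1 / enn2real (p i)))"
proof -
  have "(\<lambda>_. undefined) \<in> PiE {d..<d} (\<lambda>_. UNIV :: real set)" by simp
  from mixed_partial_indicator_PiE[OF assms order_refl this]
  show ?thesis by (simp add: mixed_norm_def)
qed

lemma ennreal_positive_prod:
  assumes "\<And>i. i \<in> I \<Longrightarrow> 0 < f i" "\<And>i. i \<in> I \<Longrightarrow> f i < (top :: ennreal)"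
  shows "\<exists>C>0. (\<Prod>i\<in>I. f i) = ennreal C"
proof (intro exI conjI)
  show "0 < (\<Prod>i\<in>I. enn2real (f i))"
    using assms by (intro prod_pos) (auto simp: enn2real_positive_iff)
  have "(\<Prod>i\<in>I. f i) = (\<Prod>i\<in>I. ennreal (enn2real (f i)))"
    using assms by (intro prod.cong) auto
  also have "\<dots> = ennreal (\<Prod>i\<in>I. enn2real (f i))" by (rule prod_ennreal) simp
  finally show "(\<Prod>i\<in>I. f i) = ennreal (\<Prod>i\<in>I. enn2real (f i))" .
qed

text \<open>C collects the norms of the full sides other than j, positive and finite because these
  sides have positive finite measure. As \<open>p j\<close> is finite, E may even be empty.\<close>

lemma mixed_norm_cylinder:
  fixes p :: "nat \<Rightarrow> ennreal"
  assumes \<Omega>: "\<And>i. i < d \<Longrightarrow> \<Omega> i \<in> sets lebesgue" "\<And>i. i < d \<Longrightarrow> 0 < emeasure lebesgue (\<Omega> i)"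
      "\<And>i. i < d \<Longrightarrow> emeasure lebesgue (\<Omega> i) < top"
    and p: "\<And>i. i < d \<Longrightarrow> 0 < p i" and j: "j < d" "p j = ennreal m" "0 < m"
  shows "\<exists>C>0. \<forall>E\<in>sets lebesgue. E \<subseteq> \<Omega> j \<longrightarrow>
      mixed_norm d \<Omega> p (indicat_real (PiE {..<d} (fun_upd \<Omega> j E))) = ennreal C * enn_powr (emeasure lebesgue E) (1 / m)"
proof -
  let ?c = "\<lambda>E i. if p i = top then 1 else enn_powr (emeasure lebesgue (E i)) (1 / enn2real (p i))"
  have "0 < ?c \<Omega> i" "?c \<Omega> i < top" if "i \<in> {..<d} - {j}" for i
    using \<Omega>(2,3)[of i] that by (auto simp: zero_less_iff_neq_zero less_top[symmetric])
  then obtain C where C: "0 < C" "(\<Prod>i\<in>{..<d} - {j}. ?c \<Omega> i) = ennreal C"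
    using ennreal_positive_prod[of "{..<d} - {j}" "?c \<Omega>"] by blast
  have "mixed_norm d \<Omega> p (indicat_real (PiE {..<d} (fun_upd \<Omega> j E))) = ennreal C * enn_powr (emeasure lebesgue E) (1 / m)"
    if E: "E \<in> sets lebesgue" "E \<subseteq> \<Omega> j" for E
  proof -
    have "mixed_norm d \<Omega> p (indicat_real (PiE {..<d} (fun_upd \<Omega> j E))) = (\<Prod>i<d. ?c (fun_upd \<Omega> j E) i)"
      by (rule mixed_norm_indicator_PiE) (use \<Omega> E p j in auto)
    also have "\<dots> = ?c (fun_upd \<Omega> j E) j * (\<Prod>i\<in>{..<d} - {j}. ?c (fun_upd \<Omega> j E) i)"
      using j by (intro prod.remove) auto
    also have "(\<Prod>i\<in>{..<d} - {j}. ?c (fun_upd \<Omega> j E) i) = ennreal C"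
      unfolding C(2)[symmetric] by (rule prod.cong) auto
    finally show ?thesis using j by (simp add: mult.commute fun_upd_def)
  qed
  with C show ?thesis by blast
qed

lemma emeasure_box_PiE:
  assumes "\<And>i. i < d \<Longrightarrow> \<Omega> i \<in> sets lebesgue"
    and E: "\<And>i. i < d \<Longrightarrow> E i \<in> sets lebesgue" "\<And>i. i < d \<Longrightarrow> E i \<subseteq> \<Omega> i"
  shows "emeasure (box_measure d \<Omega>) (PiE {..<d} E) = (\<Prod>i<d. emeasure lebesgue (E i))"
proof -
  have "PiE {..<d} E \<subseteq> box_set d \<Omega>" unfolding box_set_def by (rule PiE_mono) (use E in auto)
  from emeasure_box_measure[OF assms(1) this] PiE_sets_completion(2)[OF E(1)] show ?thesis by simp
qed

lemma emeasure_cylinder: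
  assumes \<Omega>: "\<And>i. i < d \<Longrightarrow> \<Omega> i \<in> sets lebesgue" "\<And>i. i < d \<Longrightarrow> 0 < emeasure lebesgue (\<Omega> i)"
      "\<And>i. i < d \<Longrightarrow> emeasure lebesgue (\<Omega> i) < top"
    and j: "j < d"
  shows "\<exists>K>0. \<forall>E\<in>sets lebesgue. E \<subseteq> \<Omega> j \<longrightarrow>
      emeasure (box_measure d \<Omega>) (PiE {..<d} (fun_upd \<Omega> j E)) = ennreal K * emeasure lebesgue E"
proof -
  obtain K where K: "0 < K" "(\<Prod>i\<in>{..<d} - {j}. emeasure lebesgue (\<Omega> i)) = ennreal K"
    using ennreal_positive_prod[of "{..<d} - {j}" "\<lambda>i. emeasure lebesgue (\<Omega> i)"] \<Omega> by auto
  have "emeasure (box_measure d \<Omega>) (PiE {..<d} (fun_upd \<Omega> j E)) = ennreal K * emeasure lebesgue E"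
    if E: "E \<in> sets lebesgue" "E \<subseteq> \<Omega> j" for E
  proof -
    have "emeasure (box_measure d \<Omega>) (PiE {..<d} (fun_upd \<Omega> j E)) = (\<Prod>i<d. emeasure lebesgue ((fun_upd \<Omega> j E) i))"
      by (rule emeasure_box_PiE) (use \<Omega> E in auto)
    also have "\<dots> = emeasure lebesgue ((fun_upd \<Omega> j E) j)
        * (\<Prod>i\<in>{..<d} - {j}. emeasure lebesgue ((fun_upd \<Omega> j E) i))"
      using j by (intro prod.remove) auto
    also have "(\<Prod>i\<in>{..<d} - {j}. emeasure lebesgue ((fun_upd \<Omega> j E) i)) = ennreal K"
      unfolding K(2)[symmetric] by (rule prod.cong) auto
    finally show ?thesis by (simp add: mult.commute fun_upd_def)
  qed
  with K show ?thesis by blast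
qed

text \<open>The positive measure of the other sides rules out a product of the form top times
  0.\<close>

lemma emeasure_lebesgue_less_top_of_box:
  assumes "\<And>i. i < d \<Longrightarrow> \<Omega> i \<in> sets lebesgue" "\<And>i. i < d \<Longrightarrow> 0 < emeasure lebesgue (\<Omega> i)"
    and fin: "emeasure (box_measure d \<Omega>) (box_set d \<Omega>) < top" and i: "i < d"
  shows "emeasure lebesgue (\<Omega> i) < top"
proof (rule ccontr)
  assume "\<not> emeasure lebesgue (\<Omega> i) < top"
  then have "emeasure lebesgue (\<Omega> i) = top" using less_top by blast
  moreover have "(\<Prod>k\<in>{..<d} - {i}. emeasure lebesgue (\<Omega> k)) \<noteq> 0"
    using assms(2) by (auto simp: zero_less_iff_neq_zero)
  moreover have "emeasure (box_measure d \<Omega>) (box_set d \<Omega>)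
      = emeasure lebesgue (\<Omega> i) * (\<Prod>k\<in>{..<d} - {i}. emeasure lebesgue (\<Omega> k))"
    unfolding box_set_def using i assms(1) by (subst emeasure_box_PiE) (auto intro!: prod.remove)
  ultimately show False using fin by (simp add: ennreal_top_mult)
qed

subsection \<open>Lorentz quasi-norms and rearrangements\<close>

lemma less_distr_fun_of_less_rearr:
  assumes "ennreal u < rearr M f t" "0 < u"
  shows "ennreal t < distr_fun M f u"
proof (rule ccontr)
  assume "\<not> ennreal t < distr_fun M f u"
  then have "rearr M f t \<le> ennreal u"
    unfolding rearr_def using assms by (intro INF_lower) auto
  with assms show False by simp
qed

text \<open>Asking for the strict inequality only at levels below u gives the bound at u itself
  without an appeal to right continuity of the distribution function.\<close>

lemma le_rearr:
  assumes "\<And>s. 0 < s \<Longrightarrow> s < u \<Longrightarrow> ennreal t < distr_fun M f s"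
  shows "ennreal u \<le> rearr M f t"
  unfolding rearr_def
proof (rule INF_greatest)
  fix s assume "s \<in> {s. 0 < s \<and> distr_fun M f s \<le> ennreal t}"
  then have "u \<le> s" using assms[of s] by (auto simp: not_less[symmetric])
  then show "ennreal u \<le> ennreal s" by (rule ennreal_leI)
qed

text \<open>A rearrangement may be infinite; this reduces its upper bounds to real levels strictly
  below it.\<close>

lemma ennreal_le_of_reals_less:
  assumes "\<And>u. 0 < u \<Longrightarrow> ennreal u < x \<Longrightarrow> ennreal u \<le> y"
  shows "x \<le> y"
proof (rule dense_le)
  fix z assume "z < x"
  then show "z \<le> y"
    using assms[of "enn2real z"] by (cases z) (auto simp: less_top[symmetric] zero_less_iff_neq_zero le_less)
qed

lemma divide_ennreal_eq: "0 < s \<Longrightarrow> x / ennreal s = x * ennreal (1 / s)"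
  by (simp add: divide_ennreal_def inverse_ennreal inverse_eq_divide)

lemma antimono_distr_fun: "antimono (distr_fun M f)" if "f \<in> borel_measurable M"
proof (rule antimonoI)
  fix s s' :: real assume "s \<le> s'"
  have "{x \<in> space M. \<bar>f x\<bar> > s} \<in> sets M" using that by measurable
  then show "distr_fun M f s' \<le> distr_fun M f s"
    unfolding distr_fun_def using \<open>s \<le> s'\<close> by (intro emeasure_mono) auto
qed

section \<open>Layer cake integrals and the embedding into the classical Lorentz space\<close>

lemma nn_integral_powr_Ioo:
  assumes "-1 < a" "0 \<le> c"
  shows "(\<integral>\<^sup>+x. ennreal (x powr a) * indicator {0<..<c} x \<partial>lborel) = ennreal (c powr (a + 1) / (a + 1))"
proof -
  have "((\<lambda>x. x powr a) has_integral (c powr (a + 1) / (a + 1))) {0<..<c}"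
    using has_integral_powr_from_0[OF assms] by (simp add: has_integral_Icc_iff_Ioo)
  from nn_integral_has_integral_lebesgue'[OF _ this] show ?thesis by simp
qed

text \<open>One direction of the layer cake formula x^Q = int_0^x Q u^(Q-1) du, tested at real w <
  x^Q so that x = top is covered.\<close>

lemma enn_powr_le_nn_integral:
  assumes "0 < Q"
  shows "enn_powr x Q \<le> (\<integral>\<^sup>+u. ennreal (Q * u powr (Q - 1)) * indicator {u. 0 < u \<and> ennreal u < x} u \<partial>lborel)"
    (is "_ \<le> ?I")
proof (rule ennreal_le_of_reals_less)
  fix w assume w: "0 < w" "ennreal w < enn_powr x Q"
  define u where "u = w powr (1 / Q)"
  have u: "0 < u" "w = u powr Q" using w assms by (auto simp: u_def powr_powr)
  have "\<not> x \<le> ennreal u"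
  proof
    assume "x \<le> ennreal u"
    then have "enn_powr x Q \<le> ennreal w" using enn_powr_mono[of x "ennreal u" Q] assms u
      by (simp add: enn_powr_ennreal)
    with w show False by simp
  qed
  then have ux: "ennreal u < x" by simp
  have "ennreal w = ennreal Q * ennreal (u powr ((Q - 1) + 1) / ((Q - 1) + 1))"
    using assms u by (simp flip: ennreal_mult)
  also have "\<dots> = (\<integral>\<^sup>+v. ennreal Q * (ennreal (v powr (Q - 1)) * indicator {0<..<u} v) \<partial>lborel)"
    using assms u by (subst nn_integral_cmult) (simp_all add: nn_integral_powr_Ioo)
  also have "\<dots> \<le> ?I"
    using assms ux
    by (intro nn_integral_mono)
       (auto simp: ennreal_mult split: split_indicator intro: less_trans[OF ennreal_lessI ux])
  finally show "ennreal w \<le> ?I" .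
qed

text \<open>A functional of the profile u -> \<open>N u\<close> alone, which separates the analysis
  in the level u from the mixed norm that produces the profile.\<close>

definition lorentz_qnorm :: "ennreal \<Rightarrow> (real \<Rightarrow> ennreal) \<Rightarrow> ennreal" where
  "lorentz_qnorm q N = (if q = top then (SUP u\<in>{0<..}. ennreal u * N u)
      else enn_powr
        (\<integral>\<^sup>+ u\<in>{0<..}. ennreal (u powr enn2real q) * enn_powr (N u) (enn2real q) / ennreal u \<partial>lborel)
        (1 / enn2real q))"

lemma mixed_lorentz_norm_eq:
  "mixed_lorentz_norm d \<Omega> p q f
    = lorentz_qnorm q (\<lambda>u. mixed_norm d \<Omega> p (indicat_real {x \<in> box_set d \<Omega>. \<bar>f x\<bar> > u}))"
  by (simp add: mixed_lorentz_norm_def lorentz_qnorm_def Let_def)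

text \<open>If u lies below the rearrangement at t, then N s >= c t^(1/m) for all 0 < s <= u, and
  such a profile has Lorentz quasi-norm at least a multiple of u t^(1/m). For q = top the single
  level s = u is enough; for finite q the levels in (u/2, u) are used.\<close>

lemma rearr_le_lorentz_qnorm:
  assumes c: "0 < c" and m: "0 < m" and q: "0 < q"
  shows "\<exists>B>0. \<forall>f N t. f \<in> borel_measurable M \<longrightarrow> 0 < t \<longrightarrow>
      (\<forall>u>0. ennreal c * enn_powr (distr_fun M f u) (1 / m) \<le> N u) \<longrightarrow>
      rearr M f t \<le> ennreal (B * t powr (- 1 / m)) * lorentz_qnorm q N"
proof -
  define Q where "Q = enn2real q"
  \<comment> \<open>For finite q the first 2 is the loss from s >= u / 2, and
    \<open>2 powr (1 / Q)\<close> the loss from the length u / 2 of the interval weighted by 1 /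
    u.\<close>
  define B where "B = (if q = top then 1 / c else 2 * 2 powr (1 / Q) / c)"
  have B: "0 < B" using c by (simp add: B_def)
  have "rearr M f t \<le> ennreal (B * t powr (- 1 / m)) * lorentz_qnorm q N"
    if f: "f \<in> borel_measurable M" and t: "0 < t"
      and N: "\<And>u. 0 < u \<Longrightarrow> ennreal c * enn_powr (distr_fun M f u) (1 / m) \<le> N u" for f N t
  proof (rule ennreal_le_of_reals_less)
    fix u assume u: "0 < u" "ennreal u < rearr M f t"
    define a where "a = c * t powr (1 / m)"
    have a: "0 < a" using c t by (simp add: a_def)
    have Nge: "ennreal a \<le> N s" if s: "0 < s" "s \<le> u" for s
    proof -
      have "ennreal t \<le> distr_fun M f s"
        using less_distr_fun_of_less_rearr[OF u(2,1)] antimonoD[OF antimono_distr_fun[OF f] s(2)] by simp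
      then have "ennreal c * enn_powr (ennreal t) (1 / m) \<le> ennreal c * enn_powr (distr_fun M f s) (1 / m)"
        using m by (intro mult_left_mono enn_powr_mono) auto
      also have "\<dots> \<le> N s" by (rule N[OF s(1)])
      finally show ?thesis using c t by (simp add: a_def enn_powr_ennreal ennreal_mult)
    qed
    have inv: "t powr (- 1 / m) * t powr (1 / m) = 1" using t by (simp flip: powr_add)
    show "ennreal u \<le> ennreal (B * t powr (- 1 / m)) * lorentz_qnorm q N"
    proof (cases "q = top")
      case True
      have "ennreal u = ennreal (B * t powr (- 1 / m)) * (ennreal u * ennreal a)"
        using True c u a t inv
        by (simp add: B_def a_def field_simps flip: ennreal_mult)
      also have "ennreal u * ennreal a \<le> ennreal u * N u" using Nge[of u] u by (intro mult_left_mono) auto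
      also have "ennreal u * N u \<le> lorentz_qnorm q N"
        using True u by (auto simp: lorentz_qnorm_def intro!: SUP_upper)
      finally show ?thesis by (simp add: mult_left_mono)
    next
      case False
      have Q: "0 < Q" using q False by (simp add: Q_def enn2real_positive_iff less_top)
      \<comment> \<open>A lower bound for the integrand on (u/2, u), each factor taken at its worst
        endpoint.\<close>
      define k where "k = (u / 2) powr Q * a powr Q * (1 / u)"
      have k: "0 \<le> k" using u by (simp add: k_def)
      have "(\<integral>\<^sup>+s. ennreal k * indicator {u / 2<..<u} s \<partial>lborel)
          \<le> (\<integral>\<^sup>+ s\<in>{0<..}. ennreal (s powr Q) * enn_powr (N s) Q / ennreal s \<partial>lborel)"
      proof (intro nn_integral_mono)
        fix s
        have "ennreal k \<le> ennreal (s powr Q) * enn_powr (N s) Q / ennreal s" if s: "u / 2 < s" "s < u"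
        proof -
          have "enn_powr (ennreal a) Q \<le> enn_powr (N s) Q"
            using Nge[of s] s u Q by (intro enn_powr_mono) auto
          then have "ennreal ((u / 2) powr Q) * ennreal (a powr Q) * ennreal (1 / u)
              \<le> ennreal (s powr Q) * enn_powr (N s) Q * ennreal (1 / s)"
            using s u Q a by (intro mult_mono ennreal_leI powr_mono2) (auto simp: enn_powr_ennreal frac_le)
          then show ?thesis using s u by (simp add: k_def divide_ennreal_eq flip: ennreal_mult)
        qed
        then show "ennreal k * indicator {u / 2<..<u} s
            \<le> ennreal (s powr Q) * enn_powr (N s) Q / ennreal s * indicator {0<..} s"
          using u by (auto split: split_indicator)
      qed
      also have "(\<integral>\<^sup>+s. ennreal k * indicator {u / 2<..<u} s \<partial>lborel) = ennreal (k * (u / 2))"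
        using u k by (simp add: nn_integral_cmult_indicator flip: ennreal_mult)
      also have "k * (u / 2) = (u * a / 2) powr Q / 2"
        using u a by (simp add: k_def powr_mult powr_divide)
      finally have "enn_powr (ennreal ((u * a / 2) powr Q / 2)) (1 / Q) \<le> lorentz_qnorm q N"
        using False Q by (auto simp: lorentz_qnorm_def Q_def intro!: enn_powr_mono)
      moreover have "((u * a / 2) powr Q / 2) powr (1 / Q) = u * a / (2 * 2 powr (1 / Q))"
        using u a Q by (simp add: powr_divide powr_mult powr_powr)
      ultimately have "ennreal (u * a / (2 * 2 powr (1 / Q))) \<le> lorentz_qnorm q N"
        by (simp add: enn_powr_ennreal)
      then have "ennreal (B * t powr (- 1 / m)) * ennreal (u * a / (2 * 2 powr (1 / Q)))
          \<le> ennreal (B * t powr (- 1 / m)) * lorentz_qnorm q N" by (rule mult_left_mono) simp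
      moreover have "B * t powr (- 1 / m) * (u * a / (2 * 2 powr (1 / Q))) = u"
        using False c inv by (simp add: B_def a_def field_simps)
      ultimately show ?thesis using B u a by (simp flip: ennreal_mult)
    qed
  qed
  then show ?thesis using B by blast
qed

text \<open>Insert the layer cake formula for the Q-th power of the rearrangement. A level u below
  the rearrangement at t forces t < D u, so after exchanging the integrals the inner one is int_0^(D
  u) t^(Q/m - 1) / m dt = (D u)^(Q/m) / Q, and 1/Q cancels the factor Q of the layer cake.\<close>

lemma nn_integral_rearr_le:
  assumes c: "0 < c" and m: "0 < m" and Q: "0 < Q" and fin: "emeasure M (space M) < top"
    and f: "f \<in> borel_measurable M"
    and N: "\<And>u. 0 < u \<Longrightarrow> ennreal c * enn_powr (distr_fun M f u) (1 / m) \<le> N u"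
  shows "(\<integral>\<^sup>+t. enn_powr (rearr M f t) Q * ennreal (t powr (Q / m - 1) / m) * indicator {0<..} t \<partial>lborel)
    \<le> ennreal (c powr (- Q)) * (\<integral>\<^sup>+ u\<in>{0<..}. ennreal (u powr Q) * enn_powr (N u) Q / ennreal u \<partial>lborel)"
    (is "?L \<le> _ * ?I")
proof -
  interpret finite_measure M by (rule finite_measureI) (use fin in auto)
  define D where "D = (\<lambda>u. measure M {x \<in> space M. \<bar>f x\<bar> > u})"
  have D: "distr_fun M f u = ennreal (D u)" for u
    by (simp add: distr_fun_def D_def emeasure_eq_measure)
  have D0: "0 \<le> D u" for u by (simp add: D_def)
  \<comment> \<open>Monotone functions are Borel; this yields the joint measurability of
    \<open>G\<close> for Tonelli's theorem.\<close>
  have "mono (\<lambda>u. - D u)"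
    using antimonoD[OF antimono_distr_fun[OF f]] D0 by (auto simp: D intro!: monoI)
  then have "(\<lambda>u. - (- D u)) \<in> borel_measurable borel"
    by (intro borel_measurable_uminus borel_measurable_mono)
  then have [measurable]: "D \<in> borel_measurable borel" by simp
  define V where "V = (\<lambda>u. ennreal (u powr (Q - 1) * D u powr (Q / m)) * indicator {0<..} u)"
  define G where "G = (\<lambda>t u. ennreal (Q * u powr (Q - 1)) * indicator {0<..} u
      * (ennreal (t powr (Q / m - 1) / m) * of_bool (0 < t \<and> t < D u)))"
  have [measurable]: "(\<lambda>(t, u). G t u) \<in> borel_measurable (lborel \<Otimes>\<^sub>M lborel)"
    unfolding G_def by measurable
  have "(\<integral>\<^sup>+t. enn_powr (rearr M f t) Q * ennreal (t powr (Q / m - 1) / m) * indicator {0<..} t \<partial>lborel)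
      \<le> (\<integral>\<^sup>+t. (\<integral>\<^sup>+u. G t u \<partial>lborel) \<partial>lborel)"
  proof (intro nn_integral_mono)
    fix t :: real
    show "enn_powr (rearr M f t) Q * ennreal (t powr (Q / m - 1) / m) * indicator {0<..} t
        \<le> (\<integral>\<^sup>+u. G t u \<partial>lborel)"
    proof (cases "0 < t")
      case True
      have "enn_powr (rearr M f t) Q \<le> (\<integral>\<^sup>+u. ennreal (Q * u powr (Q - 1))
          * indicator {u. 0 < u \<and> ennreal u < rearr M f t} u \<partial>lborel)"
        by (rule enn_powr_le_nn_integral[OF Q])
      also have "\<dots> \<le> (\<integral>\<^sup>+u. ennreal (Q * u powr (Q - 1)) * indicator {0<..} u * of_bool (0 < t \<and> t < D u) \<partial>lborel)"
        using True less_distr_fun_of_less_rearr[of _ M f t] D0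
        by (intro nn_integral_mono) (auto simp: D ennreal_less_iff split: split_indicator)
      finally have "enn_powr (rearr M f t) Q * ennreal (t powr (Q / m - 1) / m)
          \<le> (\<integral>\<^sup>+u. ennreal (Q * u powr (Q - 1)) * indicator {0<..} u * of_bool (0 < t \<and> t < D u) \<partial>lborel)
            * ennreal (t powr (Q / m - 1) / m)"
        by (rule mult_right_mono) simp
      also have "\<dots> = (\<integral>\<^sup>+u. ennreal (Q * u powr (Q - 1)) * indicator {0<..} u * of_bool (0 < t \<and> t < D u)
            * ennreal (t powr (Q / m - 1) / m) \<partial>lborel)"
        by (rule nn_integral_multc[symmetric]) measurable
      also have "\<dots> = (\<integral>\<^sup>+u. G t u \<partial>lborel)"
        unfolding G_def by (intro nn_integral_cong) (simp add: mult_ac)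
      finally show ?thesis using True by simp
    qed simp
  qed
  also have "\<dots> = (\<integral>\<^sup>+u. (\<integral>\<^sup>+t. G t u \<partial>lborel) \<partial>lborel)"
    by (rule lborel_pair.Fubini'[symmetric]) measurable
  also have "\<dots> = (\<integral>\<^sup>+u. ennreal (u powr (Q - 1) * D u powr (Q / m)) * indicator {0<..} u \<partial>lborel)"
  proof (intro nn_integral_cong)
    fix u :: real
    have "(\<integral>\<^sup>+t. ennreal (t powr (Q / m - 1) / m) * of_bool (0 < t \<and> t < D u) \<partial>lborel)
        = (\<integral>\<^sup>+t. ennreal (1 / m) * (ennreal (t powr (Q / m - 1)) * indicator {0<..<D u} t) \<partial>lborel)"
      using m by (intro nn_integral_cong) (auto simp: ennreal_mult[symmetric] split: split_indicator)
    also have "\<dots> = ennreal (1 / m) * ennreal (D u powr (Q / m - 1 + 1) / (Q / m - 1 + 1))"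
      using m Q D0[of u] by (subst nn_integral_cmult) (simp_all add: nn_integral_powr_Ioo)
    also have "\<dots> = ennreal (D u powr (Q / m) / Q)"
      using m Q by (simp flip: ennreal_mult)
    finally have "(\<integral>\<^sup>+t. ennreal (t powr (Q / m - 1) / m) * of_bool (0 < t \<and> t < D u) \<partial>lborel)
        = ennreal (D u powr (Q / m) / Q)" .
    then have "(\<integral>\<^sup>+t. G t u \<partial>lborel)
        = ennreal (Q * u powr (Q - 1)) * indicator {0<..} u * ennreal (D u powr (Q / m) / Q)"
      unfolding G_def by (subst nn_integral_cmult) simp_all
    also have "\<dots> = ennreal (u powr (Q - 1) * D u powr (Q / m)) * indicator {0<..} u"
      using Q by (auto simp: ennreal_mult[symmetric] split: split_indicator)
    finally show "(\<integral>\<^sup>+t. G t u \<partial>lborel) = ennreal (u powr (Q - 1) * D u powr (Q / m)) * indicator {0<..} u" .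
  qed
  finally have le: "?L \<le> (\<integral>\<^sup>+u. V u \<partial>lborel)" unfolding V_def .
  \<comment> \<open>The constant is moved past the integral of the measurable \<open>V\<close>,
    since the integrand containing N may be nonmeasurable.\<close>
  have "ennreal (c powr Q) * (\<integral>\<^sup>+u. V u \<partial>lborel) = (\<integral>\<^sup>+u. ennreal (c powr Q) * V u \<partial>lborel)"
    by (rule nn_integral_cmult[symmetric]) (simp add: V_def)
  also have "\<dots> \<le> ?I"
  proof (intro nn_integral_mono)
    fix u :: real
    have "ennreal (c powr Q) * ennreal (u powr (Q - 1) * D u powr (Q / m))
        \<le> ennreal (u powr Q) * enn_powr (N u) Q / ennreal u" if u: "0 < u"
    proof -
      have "enn_powr (ennreal c * enn_powr (distr_fun M f u) (1 / m)) Q \<le> enn_powr (N u) Q"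
        using N[OF u] Q by (intro enn_powr_mono) auto
      then have "ennreal (c powr Q * D u powr (Q / m)) \<le> enn_powr (N u) Q"
        using c D0[of u] by (simp add: D enn_powr_mult enn_powr_ennreal powr_powr ennreal_mult)
      then have "ennreal (u powr Q) * ennreal (c powr Q * D u powr (Q / m)) * ennreal (1 / u)
          \<le> ennreal (u powr Q) * enn_powr (N u) Q * ennreal (1 / u)"
        by (intro mult_left_mono mult_right_mono) auto
      moreover have "u powr (Q - 1) = u powr Q / u" using u by (simp add: powr_diff)
      ultimately show ?thesis using u by (simp add: divide_ennreal_eq ennreal_mult[symmetric] mult_ac)
    qed
    then show "ennreal (c powr Q) * V u
        \<le> ennreal (u powr Q) * enn_powr (N u) Q / ennreal u * indicator {0<..} u"
      by (auto simp: V_def split: split_indicator)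
  qed
  finally have "ennreal (c powr (- Q)) * (ennreal (c powr Q) * (\<integral>\<^sup>+u. V u \<partial>lborel))
      \<le> ennreal (c powr (- Q)) * ?I" by (rule mult_left_mono) simp
  moreover have "ennreal (c powr (- Q)) * (ennreal (c powr Q) * x) = x" for x
  proof -
    have "c powr (- Q) * c powr Q = 1" using c by (simp flip: powr_add)
    then show ?thesis by (simp flip: ennreal_mult mult.assoc)
  qed
  ultimately show ?thesis using le by simp
qed

section \<open>The gauge t^(-1/m) and the profiles of the test functions\<close>

lemma DERIV_powr_const:
  "0 < t \<Longrightarrow> ((\<lambda>t. t powr a) has_real_derivative a * t powr (a - 1)) (at t)"
  by (auto intro!: derivative_eq_intros)

lemma deriv_powr_const: "0 < t \<Longrightarrow> deriv (\<lambda>t. t powr a) t = a * t powr (a - 1)" for t a :: real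
  by (rule DERIV_imp_deriv[OF DERIV_powr_const])

lemma envelope_gauge_powr:
  assumes "a \<le> 0"
  shows "envelope_gauge (\<lambda>t. t powr a)"
  unfolding envelope_gauge_def
proof (intro conjI allI impI)
  show "antimono_on {0<..} (\<lambda>t. t powr a)"
    using assms by (intro monotone_onI) (auto intro: powr_mono2')
  show "(\<lambda>t. t powr a) differentiable at t" if "0 < t" for t
    using DERIV_powr_const[OF that] real_differentiable_def by blast
  have "continuous_on {0<..} (\<lambda>t. a * t powr (a - 1))"
    by (intro continuous_intros) auto
  then show "continuous_on {0<..} (deriv (\<lambda>t. t powr a))"
    by (rule continuous_on_eq) (simp add: deriv_powr_const)
qed auto

text \<open>For this gauge the logarithmic derivative gives 1 / (m t) and dividing by the gauge
  gives t^(v/m); together they form the weight of \<open>nn_integral_rearr_le\<close>.\<close>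

lemma envelope_integral_powr:
  assumes m: "0 < m" and v: "0 < v" "v \<noteq> top"
  shows "envelope_integral M (\<lambda>t. t powr (- 1 / m)) v \<epsilon> f
    = enn_powr (\<integral>\<^sup>+t. enn_powr (rearr M f t) (enn2real v) * ennreal (t powr (enn2real v / m - 1) / m)
          * indicator {0<..<\<epsilon>} t \<partial>lborel) (1 / enn2real v)"
proof -
  define V where "V = enn2real v"
  have V: "0 < V" using v by (simp add: V_def enn2real_positive_iff less_top)
  have "enn_powr (rearr M f t / ennreal (t powr (- 1 / m))) V
        * ennreal (- deriv (\<lambda>t. t powr (- 1 / m)) t / t powr (- 1 / m))
      = enn_powr (rearr M f t) V * ennreal (t powr (V / m - 1) / m)" if t: "0 < t" for t
  proof -
    have "1 / t powr (- 1 / m) = t powr (1 / m)" using t by (simp add: powr_minus_divide)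
    then have 1: "enn_powr (rearr M f t / ennreal (t powr (- 1 / m))) V
        = enn_powr (rearr M f t) V * ennreal (t powr (V / m))"
      using t V by (simp add: divide_ennreal_eq enn_powr_mult enn_powr_ennreal powr_powr)
    have "t powr (- 1 / m - 1) = t powr (- 1 / m) / t" using t by (simp add: powr_diff)
    then have 2: "- deriv (\<lambda>t. t powr (- 1 / m)) t / t powr (- 1 / m) = 1 / (m * t)"
      using t by (simp add: deriv_powr_const)
    have "t powr (V / m) * (1 / (m * t)) = t powr (V / m - 1) / m" using t by (simp add: powr_diff)
    then show ?thesis unfolding 1 2 using t m by (simp add: mult.assoc flip: ennreal_mult)
  qed
  then show ?thesis using v
    by (auto simp: envelope_integral_def V_def intro!: arg_cong2[where f = enn_powr] nn_integral_cong
        split: split_indicator)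
qed

lemma nn_integral_inverse_Icc:
  assumes "0 < a" "a \<le> b"
  shows "(\<integral>\<^sup>+x. ennreal (1 / x) * indicator {a..b} x \<partial>lborel) = ennreal (ln (b / a))"
proof -
  have "((\<lambda>x. 1 / x) has_integral (ln b - ln a)) {a..b}"
    using assms
    by (intro fundamental_theorem_of_calculus)
       (auto simp: has_real_derivative_iff_has_vector_derivative[symmetric] intro!: derivative_eq_intros)
  from nn_integral_has_integral_lebesgue'[OF _ this] assms show ?thesis by (simp add: ln_div)
qed

lemma lorentz_qnorm_cong:
  "(\<And>u. 0 < u \<Longrightarrow> N u = N' u) \<Longrightarrow> lorentz_qnorm q N = lorentz_qnorm q N'"
  unfolding lorentz_qnorm_def
  by (intro if_cong refl SUP_cong arg_cong2[where f = enn_powr] nn_integral_cong)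
     (auto split: split_indicator)

text \<open>This is the profile of l times the indicator of a set of quasi-norm w. For finite q the
  constant comes from int_0^l u^(q-1) du = l^q / q.\<close>

lemma lorentz_qnorm_step_le:
  assumes q: "0 < q"
  shows "\<exists>\<kappa>>0. \<forall>l w. 0 < l \<longrightarrow> 0 \<le> w \<longrightarrow>
      lorentz_qnorm q (\<lambda>u. if u < l then ennreal w else 0) \<le> ennreal (\<kappa> * l * w)"
proof (cases "q = top")
  case True
  have "lorentz_qnorm q (\<lambda>u. if u < l then ennreal w else 0) \<le> ennreal (1 * l * w)"
    if "0 < l" "0 \<le> w" for l w :: real
    unfolding lorentz_qnorm_def if_P[OF True] using that
    by (intro SUP_least) (auto simp: ennreal_mult[symmetric] intro!: ennreal_leI mult_right_mono)
  then show ?thesis by (intro exI[of _ 1]) auto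
next
  case False
  define Q where "Q = enn2real q"
  have Q: "0 < Q" using q False by (simp add: Q_def enn2real_positive_iff less_top)
  have "lorentz_qnorm q (\<lambda>u. if u < l then ennreal w else 0) \<le> ennreal ((1 / Q) powr (1 / Q) * l * w)"
    if l: "0 < l" and w: "0 \<le> w" for l w :: real
  proof -
    have "(\<integral>\<^sup>+ u\<in>{0<..}. ennreal (u powr Q) * enn_powr (if u < l then ennreal w else 0) Q / ennreal u \<partial>lborel)
        = (\<integral>\<^sup>+ u. ennreal (w powr Q) * (ennreal (u powr (Q - 1)) * indicator {0<..<l} u) \<partial>lborel)"
      using w by (intro nn_integral_cong)
        (auto simp: enn_powr_ennreal divide_ennreal_eq ennreal_mult[symmetric] powr_diff split: split_indicator)
    also have "\<dots> = ennreal (w powr Q * (l powr Q / Q))"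
      using Q l by (subst nn_integral_cmult) (simp_all add: nn_integral_powr_Ioo flip: ennreal_mult)
    finally show ?thesis using False Q l w
      by (simp add: lorentz_qnorm_def Q_def[symmetric] enn_powr_ennreal powr_mult powr_divide powr_powr mult_ac)
  qed
  then show ?thesis using Q by (intro exI[of _ "(1 / Q) powr (1 / Q)"]) auto
qed

text \<open>The profile of the test function that excludes v < q. For u < 1 the cap L keeps the
  integral finite at 0; on [1, R) the profile is at most C / u, which leaves du / u and hence ln R.
  For q = top the same bound C / u works uniformly in R.\<close>

lemma lorentz_qnorm_truncated_le:
  assumes q: "0 < q" and m: "0 < m" and C: "0 < C" and L: "0 < L" and R: "1 \<le> R"
  shows "lorentz_qnorm q (\<lambda>u. if u < R then ennreal (C * min (u powr (- m)) L powr (1 / m)) else 0)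
    \<le> ennreal (if q = top then C
        else C * (L powr (enn2real q / m) / enn2real q + ln R) powr (1 / enn2real q))"
    (is "lorentz_qnorm q ?N \<le> _")
proof -
  have le1: "min (u powr (- m)) L powr (1 / m) \<le> 1 / u" if "0 < u" for u
  proof -
    have "min (u powr (- m)) L powr (1 / m) \<le> (u powr (- m)) powr (1 / m)"
      using m L that by (intro powr_mono2) auto
    also have "\<dots> = 1 / u" using m that unfolding powr_powr by (simp add: powr_minus_divide)
    finally show ?thesis .
  qed
  have le2: "min (u powr (- m)) L powr (1 / m) \<le> L powr (1 / m)" if "0 < u" for u
    using m L that by (intro powr_mono2) auto
  show ?thesis
  proof (cases "q = top")
    case True
    have "ennreal u * ?N u \<le> ennreal C" if "0 < u" for u
    proof (cases "u < R")
      case True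
      have "u * (C * min (u powr (- m)) L powr (1 / m)) \<le> u * (C * (1 / u))"
        using le1[OF that] that C by (intro mult_left_mono) auto
      then show ?thesis using True that C by (simp add: ennreal_leI flip: ennreal_mult)
    qed simp
    then show ?thesis using True by (auto simp: lorentz_qnorm_def intro!: SUP_least)
  next
    case False
    define Q where "Q = enn2real q"
    have Q: "0 < Q" using q False by (simp add: Q_def enn2real_positive_iff less_top)
    have "(\<integral>\<^sup>+ u\<in>{0<..}. ennreal (u powr Q) * enn_powr (?N u) Q / ennreal u \<partial>lborel)
        \<le> (\<integral>\<^sup>+u. ennreal (C powr Q) * (ennreal (L powr (Q / m)) * (ennreal (u powr (Q - 1)) * indicator {0<..<1} u)
              + ennreal (1 / u) * indicator {1..R} u) \<partial>lborel)"
    proof (intro nn_integral_mono)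
      fix u :: real
      consider "u \<le> 0 \<or> R \<le> u" | "0 < u" "u < 1" "u < R" | "1 \<le> u" "u < R" by linarith
      then show "ennreal (u powr Q) * enn_powr (?N u) Q / ennreal u * indicator {0<..} u
          \<le> ennreal (C powr Q) * (ennreal (L powr (Q / m)) * (ennreal (u powr (Q - 1)) * indicator {0<..<1} u)
              + ennreal (1 / u) * indicator {1..R} u)"
      proof cases
        case 2
        have "u powr Q * (C * min (u powr (- m)) L powr (1 / m)) powr Q * (1 / u)
            \<le> u powr Q * (C * L powr (1 / m)) powr Q * (1 / u)"
          using 2 C Q L m le2[of u] by (intro mult_right_mono mult_left_mono powr_mono2[of Q]) auto
        also have "\<dots> = C powr Q * (L powr (Q / m) * u powr (Q - 1))"
          using 2 C by (simp add: powr_mult powr_powr powr_diff)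
        finally show ?thesis using 2 C
          by (simp add: enn_powr_ennreal divide_ennreal_eq ennreal_leI flip: ennreal_mult)
      next
        case 3
        have "u powr Q * (C * min (u powr (- m)) L powr (1 / m)) powr Q * (1 / u)
            \<le> u powr Q * (C * (1 / u)) powr Q * (1 / u)"
          using 3 C Q le1[of u] by (intro mult_right_mono mult_left_mono powr_mono2[of Q]) auto
        also have "\<dots> = C powr Q * (1 / u)"
          using 3 C by (simp add: powr_mult powr_divide)
        finally show ?thesis using 3 C
          by (simp add: enn_powr_ennreal divide_ennreal_eq ennreal_leI flip: ennreal_mult)
      qed auto
    qed
    also have "\<dots> = ennreal (C powr Q) * (ennreal (L powr (Q / m)) * ennreal (1 / Q) + ennreal (ln R))"
      using Q R nn_integral_inverse_Icc[of 1 R]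
      by (simp add: nn_integral_cmult nn_integral_add nn_integral_powr_Ioo)
    also have "\<dots> = ennreal (C powr Q * (L powr (Q / m) / Q + ln R))"
      using Q R by (simp add: ennreal_mult[symmetric] ennreal_plus[symmetric] del: ennreal_plus)
    finally have "lorentz_qnorm q ?N \<le> enn_powr (ennreal (C powr Q * (L powr (Q / m) / Q + ln R))) (1 / Q)"
      using False Q by (auto simp: lorentz_qnorm_def Q_def intro!: enn_powr_mono)
    also have "\<dots> = ennreal (C * (L powr (Q / m) / Q + ln R) powr (1 / Q))"
      using C Q R by (simp add: enn_powr_ennreal powr_mult powr_powr)
    finally show ?thesis using False by (simp add: Q_def)
  qed
qed

text \<open>With x = ln R the left side will bound the Lorentz quasi-norm of the test function from
  above and the right side its envelope integral from below, where \<theta> = 1/q (0 for q = top)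
  and \<theta>' = 1/v. The larger power of x wins.\<close>

lemma powr_linear_not_bounded:
  fixes \<alpha> \<beta> b c m \<theta> \<theta>' :: real
  assumes "0 < \<alpha>" "0 < m" "0 \<le> \<theta>" "\<theta> < \<theta>'" "0 < c" "0 \<le> b"
  shows "\<exists>x\<ge>x0. (b + x) powr \<theta> * c < (\<alpha> * (m * x + \<beta>)) powr \<theta>'"
proof -
  have "filterlim (\<lambda>x. x powr (\<theta>' - \<theta>)) at_top at_top" using assms by real_asymp
  then have "eventually (\<lambda>x. 2 powr \<theta> * c / (\<alpha> * m / 2) powr \<theta>' < x powr (\<theta>' - \<theta>)) at_top"
    by (simp add: filterlim_at_top_dense)
  \<comment> \<open>Beyond these thresholds b + x <= 2 x and m x + \<beta> >= m x / 2, so both sides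
    compare with pure powers of x.\<close>
  moreover have "eventually (\<lambda>x. max (max x0 b) (max 1 (2 * \<bar>\<beta>\<bar> / m)) \<le> x) at_top"
    by (rule eventually_ge_at_top)
  ultimately have "eventually (\<lambda>x. 2 powr \<theta> * c / (\<alpha> * m / 2) powr \<theta>' < x powr (\<theta>' - \<theta>) \<and>
      max (max x0 b) (max 1 (2 * \<bar>\<beta>\<bar> / m)) \<le> x) at_top"
    by (rule eventually_conj)
  then obtain x where x: "2 powr \<theta> * c / (\<alpha> * m / 2) powr \<theta>' < x powr (\<theta>' - \<theta>)"
      "x0 \<le> x" "b \<le> x" "1 \<le> x" "2 * \<bar>\<beta>\<bar> / m \<le> x"
    unfolding eventually_at_top_linorder by auto
  have "(b + x) powr \<theta> * c \<le> (2 * x) powr \<theta> * c"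
    using x assms by (intro mult_right_mono powr_mono2) auto
  also have "\<dots> = (2 powr \<theta> * c) * x powr \<theta>" using x by (simp add: powr_mult)
  also have "\<dots> < ((\<alpha> * m / 2) powr \<theta>' * x powr (\<theta>' - \<theta>)) * x powr \<theta>"
    using x assms by (intro mult_strict_right_mono) (auto simp: field_simps)
  also have "\<dots> = (\<alpha> * m / 2 * x) powr \<theta>'"
    using x assms powr_mult[of "\<alpha> * m / 2" x \<theta>'] by (simp add: powr_diff)
  also have "\<dots> \<le> (\<alpha> * (m * x + \<beta>)) powr \<theta>'"
  proof (intro powr_mono2)
    have "- \<beta> \<le> m * x / 2" using x(5) assms by (simp add: field_simps)
    then have "m * x / 2 \<le> m * x + \<beta>" by simp
    then have "\<alpha> * (m * x / 2) \<le> \<alpha> * (m * x + \<beta>)" using assms by (intro mult_left_mono) auto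
    then show "\<alpha> * m / 2 * x \<le> \<alpha> * (m * x + \<beta>)" by simp
  qed (use assms x in auto)
  finally show ?thesis using x by blast
qed

subsection \<open>The growth envelope\<close>

lemma lorentz_envelope_index_le:
  fixes \<rho> :: "'a \<Rightarrow> real"
  assumes m: "0 < m" and q: "0 < q" and C: "0 < C" and K: "0 < K" and L: "0 < L"
    and \<rho>: "\<rho> \<in> borel_measurable M"
    and N\<rho>: "\<And>s. 0 < s \<Longrightarrow> N {x \<in> space M. \<rho> x < s} = ennreal (C * min s L powr (1 / m))"
    and \<mu>\<rho>: "\<And>s. 0 < s \<Longrightarrow> emeasure M {x \<in> space M. \<rho> x < s} = ennreal (K * min s L)"
    and N0: "N {} = 0"
    and \<epsilon>: "0 < \<epsilon>" "\<epsilon> < K * L" and v: "0 < v" and c: "0 < c"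
    and bound: "\<And>f. f \<in> borel_measurable M \<Longrightarrow> lorentz_qnorm q (\<lambda>u. N {x \<in> space M. \<bar>f x\<bar> > u}) < top \<Longrightarrow>
      envelope_integral M (\<lambda>t. t powr (- 1 / m)) v \<epsilon> f \<le> ennreal c * lorentz_qnorm q (\<lambda>u. N {x \<in> space M. \<bar>f x\<bar> > u})"
  shows "q \<le> v"
proof (rule ccontr)
  assume "\<not> q \<le> v"
  then have vq: "v < q" by simp
  then have vtop: "v \<noteq> top" by auto
  define V where "V = enn2real v"
  have V: "0 < V" "v = ennreal V" using v vtop by (auto simp: V_def enn2real_positive_iff less_top)
  define Q where "Q = enn2real q"
  \<comment> \<open>With these values of \<theta> and b the single expression (b + x)^\<theta> also
    covers q = top, where the quasi-norm stays bounded as R grows.\<close>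
  define \<theta> where "\<theta> = (if q = top then 0 else 1 / Q)"
  define b where "b = (if q = top then 0 else L powr (Q / m) / Q)"
  have Q: "V < Q" if "q \<noteq> top"
  proof -
    have "q = ennreal Q" using that by (simp add: Q_def less_top)
    then show ?thesis using vq V by (simp add: ennreal_less_iff)
  qed
  have \<theta>: "0 \<le> \<theta>" "\<theta> < 1 / V" using Q V by (auto simp: \<theta>_def frac_less2)
  have b: "0 \<le> b" using Q V by (auto simp: b_def)
  define \<alpha> where "\<alpha> = K powr (V / m) / m"
  have \<alpha>: "0 < \<alpha>" using K m by (simp add: \<alpha>_def)
  \<comment> \<open>The bound x >= 1 makes \<open>x powr 0\<close> equal to 1 when q = top; the
    other bound makes K R^(-m) <= \<epsilon>, so that the interval of integration below is not
    reversed.\<close>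
  obtain x where x: "max 1 (ln (K / \<epsilon>) / m) \<le> x"
      "(b + x) powr \<theta> * (c * C) < (\<alpha> * (m * x + ln (\<epsilon> / K))) powr (1 / V)"
    using powr_linear_not_bounded[OF \<alpha> m \<theta>, of "c * C" b "max 1 (ln (K / \<epsilon>) / m)" "ln (\<epsilon> / K)"] c C b by auto
  define R where "R = exp x"
  have R: "1 \<le> R" "ln R = x" using x(1) by (auto simp: R_def)
  have "ln (K / \<epsilon>) \<le> m * x" using x(1) m by (simp add: field_simps)
  then have "exp (ln (K / \<epsilon>)) \<le> exp (m * x)" by simp
  then have "K / \<epsilon> \<le> exp (m * x)" using K \<epsilon> by simp
  also have "exp (m * x) = R powr m" using R by (simp add: R_def powr_def)
  finally have K\<epsilon>: "K * R powr (- m) \<le> \<epsilon>"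
    using K \<epsilon> R by (simp add: powr_minus field_simps)
  \<comment> \<open>The extremal function \<rho>^(-1/m), capped at height R because for finite q the
    integral defining its quasi-norm diverges at large levels.\<close>
  define f where "f = (\<lambda>x. max (\<rho> x) (R powr (- m)) powr (- 1 / m))"
  have f_meas: "f \<in> borel_measurable M" unfolding f_def using \<rho> by measurable
  have level: "{x \<in> space M. \<bar>f x\<bar> > u} = (if u < R then {x \<in> space M. \<rho> x < u powr (- m)} else {})"
    if u: "0 < u" for u
  proof -
    have less_iff: "u < y powr (- 1 / m) \<longleftrightarrow> y < u powr (- m)" if y: "0 < y" for y
    proof -
      have "u = (u powr (- m)) powr (- 1 / m)" using u m by (simp add: powr_powr)
      then have "u < y powr (- 1 / m) \<longleftrightarrow> (u powr (- m)) powr (- 1 / m) < y powr (- 1 / m)" by simp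
      also have "\<dots> \<longleftrightarrow> y < u powr (- m)"
        using powr_less_mono2_neg[of "- 1 / m" y "u powr (- m)"] powr_mono2'[of "- 1 / m" "u powr (- m)" y] u m y
        by (auto simp: not_less[symmetric])
      finally show ?thesis .
    qed
    have "R powr (- m) < u powr (- m) \<longleftrightarrow> u < R"
      using powr_less_mono2_neg[of "- m" u R] powr_mono2'[of "- m" R u] u R m by (auto simp: not_less[symmetric])
    moreover have "\<bar>f y\<bar> > u \<longleftrightarrow> \<rho> y < u powr (- m) \<and> R powr (- m) < u powr (- m)" for y
    proof -
      have "0 < max (\<rho> y) (R powr (- m))" using R by (simp add: less_max_iff_disj)
      from less_iff[OF this] show ?thesis by (simp add: f_def)
    qed
    ultimately show ?thesis by auto
  qed
  have "lorentz_qnorm q (\<lambda>u. N {x \<in> space M. \<bar>f x\<bar> > u})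
      = lorentz_qnorm q (\<lambda>u. if u < R then ennreal (C * min (u powr (- m)) L powr (1 / m)) else 0)"
    by (rule lorentz_qnorm_cong) (simp add: level N\<rho> N0)
  also have "\<dots> \<le> ennreal (C * (b + x) powr \<theta>)"
    using lorentz_qnorm_truncated_le[OF q m C L R(1)] R x(1)
    by (auto simp: b_def \<theta>_def Q_def split: if_splits)
  finally have norm: "lorentz_qnorm q (\<lambda>u. N {x \<in> space M. \<bar>f x\<bar> > u}) \<le> ennreal (C * (b + x) powr \<theta>)" .
  \<comment> \<open>In this range of t neither the truncation nor the cap \<open>L\<close> is felt,
    so the rearrangement is at least the inverse of u -> K u^(-m).\<close>
  have rearr: "ennreal ((t / K) powr (- 1 / m)) \<le> rearr M f t" if t: "K * R powr (- m) \<le> t" "t < \<epsilon>" for t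
  proof (rule le_rearr)
    fix s assume s: "0 < s" "s < (t / K) powr (- 1 / m)"
    have "0 < K * R powr (- m)" using K R by simp
    then have t0: "0 < t" using t by linarith
    have "s powr (- m) > ((t / K) powr (- 1 / m)) powr (- m)"
      using s m by (intro powr_less_mono2_neg) auto
    then have 1: "t < K * s powr (- m)" using m K t0 by (simp add: powr_powr field_simps)
    have "(t / K) powr (- 1 / m) \<le> (R powr (- m)) powr (- 1 / m)"
      using t K m R by (intro powr_mono2') (auto simp: field_simps)
    also have "\<dots> = R" using R m by (simp add: powr_powr)
    finally have "s < R" using s by simp
    then have "distr_fun M f s = ennreal (K * min (s powr (- m)) L)"
      using s \<mu>\<rho>[of "s powr (- m)"] by (simp add: distr_fun_def level)
    moreover have "t < K * min (s powr (- m)) L" using 1 t(2) \<epsilon> by (simp add: min_def)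
    ultimately show "ennreal t < distr_fun M f s" using t0 by (simp add: ennreal_less_iff)
  qed
  \<comment> \<open>On this interval \<alpha> / t bounds the envelope integrand from below; its
    integral is logarithmic and hence linear in x = ln R.\<close>
  have "ennreal (\<alpha> * (m * x + ln (\<epsilon> / K)))
      = (\<integral>\<^sup>+t. ennreal \<alpha> * (ennreal (1 / t) * indicator {K * R powr (- m)..\<epsilon>} t) \<partial>lborel)"
  proof -
    have "\<epsilon> / (K * R powr (- m)) = (\<epsilon> / K) * R powr m" using R by (simp add: powr_minus field_simps)
    moreover have "ln ((\<epsilon> / K) * R powr m) = ln (\<epsilon> / K) + m * x"
      using \<epsilon> K R by (subst ln_mult) (auto simp: ln_powr)
    ultimately have "ln (\<epsilon> / (K * R powr (- m))) = m * x + ln (\<epsilon> / K)" by simp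
    moreover have "0 < K * R powr (- m)" using K R by simp
    ultimately show ?thesis
      using nn_integral_inverse_Icc[of "K * R powr (- m)" \<epsilon>] K\<epsilon> \<alpha>
      by (simp add: nn_integral_cmult ennreal_mult')
  qed
  also have "\<dots> = (\<integral>\<^sup>+t. ennreal \<alpha> * (ennreal (1 / t) * indicator {K * R powr (- m)..<\<epsilon>} t) \<partial>lborel)"
  proof (rule nn_integral_cong_AE)
    show "AE t in lborel. ennreal \<alpha> * (ennreal (1 / t) * indicator {K * R powr (- m)..\<epsilon>} t)
        = ennreal \<alpha> * (ennreal (1 / t) * indicator {K * R powr (- m)..<\<epsilon>} t)"
      using AE_lborel_singleton[of \<epsilon>] by eventually_elim (auto split: split_indicator)
  qed
  also have "\<dots> \<le> (\<integral>\<^sup>+t. enn_powr (rearr M f t) V * ennreal (t powr (V / m - 1) / m)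
          * indicator {0<..<\<epsilon>} t \<partial>lborel)"
  proof (intro nn_integral_mono)
    fix t :: real
    have pos: "0 < K * R powr (- m)" using K R by simp
    have "ennreal \<alpha> * ennreal (1 / t) \<le> enn_powr (rearr M f t) V * ennreal (t powr (V / m - 1) / m)"
      if t: "K * R powr (- m) \<le> t" "t < \<epsilon>"
    proof -
      have t0: "0 < t" using pos t by linarith
      have "\<alpha> * (1 / t) = ((t / K) powr (- 1 / m)) powr V * (t powr (V / m - 1) / m)"
      proof -
        have "((t / K) powr (- 1 / m)) powr V = K powr (V / m) / t powr (V / m)"
          using t0 K by (simp add: powr_powr powr_minus powr_divide)
        moreover have "t powr (V / m - 1) = t powr (V / m) / t" using t0 by (simp add: powr_diff)
        ultimately show ?thesis using t0 by (simp add: \<alpha>_def)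
      qed
      moreover have "enn_powr (ennreal ((t / K) powr (- 1 / m))) V \<le> enn_powr (rearr M f t) V"
        using rearr[OF t] V by (intro enn_powr_mono) auto
      then have "ennreal (((t / K) powr (- 1 / m)) powr V) * ennreal (t powr (V / m - 1) / m)
          \<le> enn_powr (rearr M f t) V * ennreal (t powr (V / m - 1) / m)"
        by (intro mult_right_mono) (auto simp: enn_powr_ennreal)
      ultimately show ?thesis using \<alpha> t0 m by (simp flip: ennreal_mult)
    qed
    then show "ennreal \<alpha> * (ennreal (1 / t) * indicator {K * R powr (- m)..<\<epsilon>} t)
        \<le> enn_powr (rearr M f t) V * ennreal (t powr (V / m - 1) / m) * indicator {0<..<\<epsilon>} t"
      using pos by (auto split: split_indicator)
  qed
  finally have "enn_powr (ennreal (\<alpha> * (m * x + ln (\<epsilon> / K)))) (1 / V)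
      \<le> envelope_integral M (\<lambda>t. t powr (- 1 / m)) v \<epsilon> f"
    unfolding envelope_integral_powr[OF m v vtop] V_def[symmetric] using V by (intro enn_powr_mono) auto
  also have "\<dots> \<le> ennreal c * lorentz_qnorm q (\<lambda>u. N {x \<in> space M. \<bar>f x\<bar> > u})"
    using norm by (intro bound f_meas) (auto intro: le_less_trans)
  also have "\<dots> \<le> ennreal c * ennreal (C * (b + x) powr \<theta>)"
    using norm by (rule mult_left_mono) simp
  also have "\<dots> = ennreal ((b + x) powr \<theta> * (c * C))"
    using c C by (simp add: ennreal_mult[symmetric] mult_ac)
  also have "\<dots> < ennreal ((\<alpha> * (m * x + ln (\<epsilon> / K))) powr (1 / V))"
  proof (rule ennreal_lessI[OF _ x(2)])
    have "0 \<le> (b + x) powr \<theta> * (c * C)" using c C by simp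
    then show "0 < (\<alpha> * (m * x + ln (\<epsilon> / K))) powr (1 / V)" using x(2) by (rule le_less_trans)
  qed
  also have "0 \<le> m * x + ln (\<epsilon> / K)"
    using \<open>ln (K / \<epsilon>) \<le> m * x\<close> K \<epsilon> by (simp add: ln_div)
  then have "ennreal ((\<alpha> * (m * x + ln (\<epsilon> / K))) powr (1 / V))
      = enn_powr (ennreal (\<alpha> * (m * x + ln (\<epsilon> / K)))) (1 / V)"
    using \<alpha> by (simp add: enn_powr_ennreal)
  finally show False by simp
qed

text \<open>Mixed norms enter only through a set function N. \<open>Nge\<close> for all sets yields
  the upper estimates; the exact values on the sublevel sets of one function \<rho> yield the test
  functions.\<close>

lemma has_growth_envelope_lorentz:
  fixes \<rho> :: "'a \<Rightarrow> real"
  assumes m: "0 < m" and q: "0 < q" and C: "0 < C" and K: "0 < K" and L: "0 < L"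
    and fin: "emeasure M (space M) < top"
    and c: "0 < c" and Nge: "\<And>A. A \<in> sets M \<Longrightarrow> ennreal c * enn_powr (emeasure M A) (1 / m) \<le> N A"
    and \<rho>: "\<rho> \<in> borel_measurable M"
    and N\<rho>: "\<And>s. 0 < s \<Longrightarrow> N {x \<in> space M. \<rho> x < s} = ennreal (C * min s L powr (1 / m))"
    and \<mu>\<rho>: "\<And>s. 0 < s \<Longrightarrow> emeasure M {x \<in> space M. \<rho> x < s} = ennreal (K * min s L)"
    and N0: "N {} = 0"
    and nrm: "\<And>f. nrm f = lorentz_qnorm q (\<lambda>u. N {x \<in> space M. \<bar>f x\<bar> > u})"
  shows "has_growth_envelope M {f \<in> borel_measurable M. nrm f < top} nrm (\<lambda>t. t powr (- 1 / m)) q"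
proof -
  let ?X = "{f \<in> borel_measurable M. nrm f < top}"
  have N: "ennreal c * enn_powr (distr_fun M f u) (1 / m) \<le> N {x \<in> space M. \<bar>f x\<bar> > u}"
    if "f \<in> borel_measurable M" for f u
    unfolding distr_fun_def using that by (intro Nge) measurable
  obtain B where B: "0 < B" and "\<forall>f N t. f \<in> borel_measurable M \<longrightarrow> 0 < t \<longrightarrow>
      (\<forall>u>0. ennreal c * enn_powr (distr_fun M f u) (1 / m) \<le> N u) \<longrightarrow>
      rearr M f t \<le> ennreal (B * t powr (- 1 / m)) * lorentz_qnorm q N"
    using rearr_le_lorentz_qnorm[OF c m q, of M] by blast
  then have weak: "rearr M f t \<le> ennreal (B * t powr (- 1 / m)) * nrm f"
    if "f \<in> borel_measurable M" "0 < t" for f t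
    unfolding nrm using that N[OF that(1)] by simp
  obtain \<kappa> where \<kappa>: "0 < \<kappa>" and step: "\<And>l w. 0 < l \<Longrightarrow> 0 \<le> w \<Longrightarrow>
      lorentz_qnorm q (\<lambda>u. if u < l then ennreal w else 0) \<le> ennreal (\<kappa> * l * w)"
    using lorentz_qnorm_step_le[OF q] by blast
  \<comment> \<open>Normalises the test function below: the bound from \<open>step\<close> for its
    quasi-norm becomes exactly 1.\<close>
  define A where "A = 1 / (\<kappa> * C * (2 / K) powr (1 / m))"
  have A: "0 < A" using \<kappa> C K by (simp add: A_def)
  have lower: "ennreal (A * t powr (- 1 / m)) \<le> growth_envelope_fun M ?X nrm t"
    if t: "0 < t" "t < K * L / 2" for t
  proof -
    \<comment> \<open>The factor 2 gives the sublevel set measure 2 t, strictly above t as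
      \<open>le_rearr\<close> demands; t < K L / 2 keeps s below the cap L.\<close>
    define s where "s = 2 * t / K"
    have s: "0 < s" "s < L" "K * s = 2 * t" using t K by (auto simp: s_def field_simps)
    define l where "l = A * t powr (- 1 / m)"
    have l: "0 < l" using A t by (simp add: l_def)
    define f where "f = (\<lambda>x. l * of_bool (\<rho> x < s))"
    have f_meas: "f \<in> borel_measurable M" unfolding f_def using \<rho> by measurable
    have level: "{x \<in> space M. \<bar>f x\<bar> > u} = (if u < l then {x \<in> space M. \<rho> x < s} else {})" if "0 < u" for u
      using that l by (auto simp: f_def)
    have "nrm f = lorentz_qnorm q (\<lambda>u. if u < l then ennreal (C * s powr (1 / m)) else 0)"
      unfolding nrm using s by (intro lorentz_qnorm_cong) (simp add: level N\<rho> N0)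
    also have "\<dots> \<le> ennreal (\<kappa> * l * (C * s powr (1 / m)))" using l C by (intro step) auto
    also have "\<kappa> * l * (C * s powr (1 / m)) = 1"
    proof -
      have "s powr (1 / m) = (2 / K) powr (1 / m) * t powr (1 / m)"
        using t K by (simp add: s_def powr_mult[symmetric])
      moreover have "t powr (- 1 / m) * t powr (1 / m) = 1" using t by (simp flip: powr_add)
      ultimately show ?thesis using \<kappa> C K by (simp add: l_def A_def)
    qed
    finally have f1: "nrm f \<le> 1" by simp
    then have "f \<in> {f \<in> ?X. nrm f \<le> 1}" using f_meas by (auto intro: le_less_trans)
    then have "rearr M f t \<le> growth_envelope_fun M ?X nrm t"
      unfolding growth_envelope_fun_def by (rule SUP_upper)
    moreover have "ennreal l \<le> rearr M f t"
    proof (rule le_rearr)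
      fix u assume "0 < u" "u < l"
      then have "distr_fun M f u = ennreal (2 * t)"
        using s \<mu>\<rho>[OF s(1)] by (simp add: distr_fun_def level)
      then show "ennreal t < distr_fun M f u" using t by (simp add: ennreal_less_iff)
    qed
    ultimately show ?thesis by (simp add: l_def)
  qed
  have upper: "growth_envelope_fun M ?X nrm t \<le> ennreal (B * t powr (- 1 / m))" if t: "0 < t" for t
    unfolding growth_envelope_fun_def
  proof (rule SUP_least)
    fix f assume "f \<in> {f \<in> ?X. nrm f \<le> 1}"
    then have f: "f \<in> borel_measurable M" "nrm f \<le> 1" by auto
    have "rearr M f t \<le> ennreal (B * t powr (- 1 / m)) * nrm f" by (rule weak[OF f(1) t])
    also have "\<dots> \<le> ennreal (B * t powr (- 1 / m)) * 1" using f(2) by (rule mult_left_mono) simp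
    finally show "rearr M f t \<le> ennreal (B * t powr (- 1 / m))" by simp
  qed
  have index: "q = Inf {v. 0 < v \<and> (\<exists>c>0. \<forall>f\<in>?X.
      envelope_integral M (\<lambda>t. t powr (- 1 / m)) v \<epsilon> f \<le> ennreal c * nrm f)}" (is "q = Inf ?S")
    if \<epsilon>: "0 < \<epsilon>" "\<epsilon> < K * L" for \<epsilon>
  proof (rule antisym)
    show "q \<le> Inf ?S"
    proof (rule Inf_greatest)
      fix v assume "v \<in> ?S"
      then obtain c' where "0 < v" "0 < c'" and
        "\<And>f. f \<in> ?X \<Longrightarrow> envelope_integral M (\<lambda>t. t powr (- 1 / m)) v \<epsilon> f \<le> ennreal c' * nrm f" by auto
      then show "q \<le> v"
        using lorentz_envelope_index_le[of m q C K L \<rho> M N \<epsilon> v c', OF m q C K L \<rho> N\<rho> \<mu>\<rho> N0 \<epsilon>] by (auto simp: nrm)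
    qed
    \<comment> \<open>The index q is itself admissible, so the infimum is attained. For q = top this
      is the pointwise estimate \<open>weak\<close>; for finite q the integral over (0, \<epsilon>)
      is dominated by the one over the half-line.\<close>
    have "\<exists>c>0. \<forall>f\<in>?X. envelope_integral M (\<lambda>t. t powr (- 1 / m)) q \<epsilon> f \<le> ennreal c * nrm f"
    proof (cases "q = top")
      case True
      have "envelope_integral M (\<lambda>t. t powr (- 1 / m)) q \<epsilon> f \<le> ennreal B * nrm f" if f: "f \<in> ?X" for f
        unfolding envelope_integral_def if_P[OF True]
      proof (rule SUP_least)
        fix t assume t: "t \<in> {0<..<\<epsilon>}"
        then have "rearr M f t \<le> ennreal (t powr (- 1 / m)) * (ennreal B * nrm f)"
          using weak[of f t] f B by (simp add: ennreal_mult mult_ac)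
        then show "rearr M f t / ennreal (t powr (- 1 / m)) \<le> ennreal B * nrm f"
          using t by (intro divide_le_posI_ennreal) (auto simp: mult.commute)
      qed
      then show ?thesis using B by blast
    next
      case False
      define Q where "Q = enn2real q"
      have Q: "0 < Q" using q False by (simp add: Q_def enn2real_positive_iff less_top)
      have "envelope_integral M (\<lambda>t. t powr (- 1 / m)) q \<epsilon> f \<le> ennreal (1 / c) * nrm f" if f: "f \<in> ?X" for f
      proof -
        let ?I = "\<integral>\<^sup>+ u\<in>{0<..}. ennreal (u powr Q) * enn_powr (N {x \<in> space M. \<bar>f x\<bar> > u}) Q / ennreal u \<partial>lborel"
        have "(\<integral>\<^sup>+t. enn_powr (rearr M f t) Q * ennreal (t powr (Q / m - 1) / m) * indicator {0<..<\<epsilon>} t \<partial>lborel)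
            \<le> (\<integral>\<^sup>+t. enn_powr (rearr M f t) Q * ennreal (t powr (Q / m - 1) / m) * indicator {0<..} t \<partial>lborel)"
          by (intro nn_integral_mono) (auto split: split_indicator)
        also have "\<dots> \<le> ennreal (c powr (- Q)) * ?I"
          using f by (intro nn_integral_rearr_le[OF c m Q fin] N) auto
        finally have "envelope_integral M (\<lambda>t. t powr (- 1 / m)) q \<epsilon> f \<le> enn_powr (ennreal (c powr (- Q)) * ?I) (1 / Q)"
          unfolding envelope_integral_powr[OF m q False] Q_def[symmetric] using Q by (intro enn_powr_mono) auto
        also have "\<dots> = ennreal ((c powr (- Q)) powr (1 / Q)) * nrm f"
          using False by (simp add: nrm lorentz_qnorm_def Q_def[symmetric] enn_powr_mult enn_powr_ennreal)
        also have "(c powr (- Q)) powr (1 / Q) = 1 / c"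
          using Q c unfolding powr_powr by (simp add: powr_minus_divide)
        finally show ?thesis .
      qed
      then show ?thesis using c by (intro exI[of _ "1 / c"]) auto
    qed
    then show "Inf ?S \<le> q" using q by (intro Inf_lower) auto
  qed
  show ?thesis
    unfolding has_growth_envelope_def
  proof (intro conjI)
    show "envelope_gauge (\<lambda>t. t powr (- 1 / m))" using m by (intro envelope_gauge_powr) auto
    show "\<exists>\<epsilon>>0. \<exists>A>0. \<exists>B>0. \<forall>t. 0 < t \<and> t < \<epsilon> \<longrightarrow>
        ennreal (A * t powr (- 1 / m)) \<le> growth_envelope_fun M ?X nrm t \<and>
        growth_envelope_fun M ?X nrm t \<le> ennreal (B * t powr (- 1 / m))"
      using A B K L lower upper by (intro exI[of _ "K * L / 2"] conjI exI[of _ A] exI[of _ B]) auto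
    show "\<exists>\<epsilon>\<^sub>0>0. \<forall>\<epsilon>. 0 < \<epsilon> \<and> \<epsilon> < \<epsilon>\<^sub>0 \<longrightarrow> q = Inf {v. 0 < v \<and> (\<exists>c>0. \<forall>f\<in>?X.
      envelope_integral M (\<lambda>t. t powr (- 1 / m)) v \<epsilon> f \<le> ennreal c * nrm f)}"
      using K L index by (intro exI[of _ "K * L"]) auto
  qed (fact q)
qed

text \<open>\<open>\<rho>\<close> pushes Lebesgue measure on \<open>S\<close> forward to Lebesgue measure on an interval of length \<open>|S|\<close>.\<close>

lemma rank_function:
  fixes S :: "real set"
  assumes S: "S \<in> lmeasurable"
  defines "\<rho> \<equiv> \<lambda>y. measure lebesgue (S \<inter> {..y})"
  shows "continuous_on UNIV \<rho>"
    and "\<And>s. 0 < s \<Longrightarrow> emeasure lebesgue {y \<in> S. \<rho> y < s} = ennreal (min s (measure lebesgue S))"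
proof -
  have Sy: "S \<inter> {..y} \<in> lmeasurable" for y
    using S by (rule fmeasurable_Int_fmeasurable) simp
  have mono: "\<rho> a \<le> \<rho> b" if "a \<le> b" for a b
    unfolding \<rho>_def using that Sy by (intro measure_mono_fmeasurable) auto
  \<comment> \<open>Passing from a to b adds at most the points of an interval of length b -
    a.\<close>
  have lip: "\<rho> b \<le> \<rho> a + (b - a)" if "a \<le> b" for a b
  proof -
    have "\<rho> b \<le> measure lebesgue ((S \<inter> {..a}) \<union> {a..b})"
      unfolding \<rho>_def using Sy by (intro measure_mono_fmeasurable fmeasurable.Un) auto
    also have "\<dots> \<le> \<rho> a + measure lebesgue {a..b}"
      unfolding \<rho>_def using Sy by (intro measure_Un_le) auto
    finally show ?thesis using that by simp
  qed
  have lipschitz: "\<bar>\<rho> b - \<rho> a\<bar> \<le> \<bar>b - a\<bar>" for a b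
    using mono[of a b] lip[of a b] mono[of b a] lip[of b a] by (cases "a \<le> b") auto
  show cont: "continuous_on UNIV \<rho>"
    unfolding continuous_on_iff dist_real_def using lipschitz le_less_trans by blast
  have [measurable]: "S \<in> sets lebesgue" using S by auto
  have lim_top: "(\<lambda>n. \<rho> (real n)) \<longlonglongrightarrow> measure lebesgue S"
  proof -
    have "(\<Union>n. S \<inter> {..real n}) = S" using real_arch_simple by auto
    moreover have "emeasure lebesgue S \<noteq> \<infinity>" using fmeasurableD2[OF S] by simp
    ultimately show ?thesis
      using Lim_measure_incseq[of "\<lambda>n. S \<inter> {..real n}" lebesgue] fmeasurableD[OF Sy]
      by (force simp: \<rho>_def incseq_def)
  qed
  have lim_bot: "(\<lambda>n. \<rho> (- real n)) \<longlonglongrightarrow> 0"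
  proof -
    have "(\<Inter>n. S \<inter> {..- real n}) = {}"
    proof (intro equalityI subsetI)
      fix y assume y: "y \<in> (\<Inter>n. S \<inter> {..- real n})"
      obtain n where "- y < real n" using reals_Archimedean2 by blast
      with y show "y \<in> {}" by (auto dest!: spec[of _ n])
    qed simp
    then show ?thesis
      using Lim_measure_decseq[of "\<lambda>n. S \<inter> {..- real n}" lebesgue] fmeasurableD[OF Sy] fmeasurableD2[OF Sy]
      by (force simp: \<rho>_def decseq_def)
  qed
  fix s :: real assume s: "0 < s"
  show "emeasure lebesgue {y \<in> S. \<rho> y < s} = ennreal (min s (measure lebesgue S))"
  proof (cases "\<exists>y. s \<le> \<rho> y")
    case False
    then have "{y \<in> S. \<rho> y < s} = S" by (auto simp: not_le)
    moreover have "measure lebesgue S \<le> s"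
      using False by (intro LIMSEQ_le_const2[OF lim_top]) (auto simp: not_le intro: less_imp_le)
    ultimately show ?thesis using S by (simp add: emeasure_eq_measure2)
  next
    case True
    \<comment> \<open>The first point where \<rho> reaches s. The limit 0 at minus infinity bounds
      the set below and continuity makes it closed, so T belongs to it and \<rho> y < s means y <
      T.\<close>
    define T where "T = Inf {y. s \<le> \<rho> y}"
    have "eventually (\<lambda>n. \<rho> (- real n) < s) sequentially"
      using lim_bot s by (rule order_tendstoD)
    then obtain n where n: "\<rho> (- real n) < s" by (auto simp: eventually_sequentially)
    have bdd: "bdd_below {y. s \<le> \<rho> y}"
    proof (rule bdd_belowI[of _ "- real n"])
      fix y assume "y \<in> {y. s \<le> \<rho> y}"
      then show "- real n \<le> y" using n mono[of y "- real n"] by (cases "- real n \<le> y") auto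
    qed
    have "closed {y. s \<le> \<rho> y}" using cont by (intro closed_Collect_le) auto
    then have T: "s \<le> \<rho> T" using closed_contains_Inf[OF _ bdd] True by (auto simp: T_def)
    have less_T: "\<rho> y < s \<longleftrightarrow> y < T" for y
    proof
      show "y < T" if "\<rho> y < s" using that T mono[of T y] by (cases "y < T") auto
      show "\<rho> y < s" if "y < T"
        using that cInf_lower[OF _ bdd, of y] by (auto simp: T_def not_le[symmetric])
    qed
    \<comment> \<open>Left of T the values are below s, and the Lipschitz bound carries this to T up
      to an arbitrary e.\<close>
    have "\<rho> T \<le> s"
    proof (rule field_le_epsilon)
      fix e :: real assume "0 < e"
      then show "\<rho> T \<le> s + e" using lip[of "T - e" T] less_T[of "T - e"] by simp
    qed
    with T have \<rho>T: "\<rho> T = s" by simp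
    have "emeasure lebesgue {y \<in> S. \<rho> y < s} = emeasure lebesgue (S \<inter> {..T} - {T})"
      by (rule arg_cong[where f = "emeasure lebesgue"]) (auto simp: less_T)
    also have "\<dots> = emeasure lebesgue (S \<inter> {..T})"
      using Sy by (intro emeasure_Diff_null_set) auto
    also have "\<dots> = ennreal s" using Sy by (simp add: emeasure_eq_measure2 \<rho>T[unfolded \<rho>_def])
    also have "s \<le> measure lebesgue S"
      unfolding \<rho>T[symmetric] \<rho>_def using S Sy by (intro measure_mono_fmeasurable) auto
    then have "ennreal s = ennreal (min s (measure lebesgue S))" by simp
    finally show ?thesis .
  qed
qed

section \<open>Application to the mixed Lorentz space\<close>

theorem corollary4p5:
  fixes d :: nat and \<Omega> :: "nat \<Rightarrow> real set" and p :: "nat \<Rightarrow> ennreal" and q :: ennreal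
  assumes "d \<ge> 1"
    and "\<And>i. i < d \<Longrightarrow> \<Omega> i \<in> sets lebesgue"
    and "\<And>i. i < d \<Longrightarrow> emeasure lebesgue (\<Omega> i) > 0"
    and "emeasure (box_measure d \<Omega>) (box_set d \<Omega>) < top"
    and "\<And>i. i < d \<Longrightarrow> 0 < p i"
    and "0 < Min (p ` {..<d})" and "Min (p ` {..<d}) < top"
    and "0 < q"
  shows "has_growth_envelope (box_measure d \<Omega>) (mixed_lorentz_space d \<Omega> p q)
           (mixed_lorentz_norm d \<Omega> p q)
           (\<lambda>t. t powr (- 1 / enn2real (Min (p ` {..<d})))) q"
proof -
  define m where "m = enn2real (Min (p ` {..<d}))"
  have m: "0 < m" "Min (p ` {..<d}) = ennreal m"
    using assms(6,7) by (auto simp: m_def enn2real_positive_iff)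
  have "Min (p ` {..<d}) \<in> p ` {..<d}" using assms(1) by (intro Min_in) (auto simp: lessThan_empty_iff)
  then obtain j where j: "j < d" "p j = ennreal m" using m by auto
  have mp: "ennreal m \<le> p i" if "i < d" for i unfolding m(2)[symmetric] using that by (intro Min_le) auto
  have fin: "emeasure lebesgue (\<Omega> i) < top" if "i < d" for i
    by (rule emeasure_lebesgue_less_top_of_box[of d]) (use assms that in auto)
  obtain c where c: "0 < c" "\<forall>A\<in>sets (box_measure d \<Omega>). ennreal c * enn_powr (emeasure (box_measure d \<Omega>) A) (1 / m)
      \<le> mixed_norm d \<Omega> p (indicat_real A)"
    using mixed_norm_indicator_ge[of d \<Omega> m p] assms(2) fin m(1) mp by blast
  obtain C where C: "0 < C" "\<forall>E\<in>sets lebesgue. E \<subseteq> \<Omega> j \<longrightarrow>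
      mixed_norm d \<Omega> p (indicat_real (PiE {..<d} (fun_upd \<Omega> j E))) = ennreal C * enn_powr (emeasure lebesgue E) (1 / m)"
    using mixed_norm_cylinder[of d \<Omega> p j m] assms(2,3,5) fin j m(1) by blast
  obtain K where K: "0 < K" "\<forall>E\<in>sets lebesgue. E \<subseteq> \<Omega> j \<longrightarrow>
      emeasure (box_measure d \<Omega>) (PiE {..<d} (fun_upd \<Omega> j E)) = ennreal K * emeasure lebesgue E"
    using emeasure_cylinder[of d \<Omega> j] assms(2,3) fin j(1) by blast
  define \<rho> where "\<rho> = (\<lambda>y. measure lebesgue (\<Omega> j \<inter> {..y}))"
  define L where "L = measure lebesgue (\<Omega> j)"
  have \<Omega>j: "\<Omega> j \<in> lmeasurable" using assms(2) fin j(1) by (simp add: fmeasurable_def)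
  have L: "0 < L" using assms(3)[OF j(1)] \<Omega>j by (simp add: L_def emeasure_eq_measure2)
  have rank: "continuous_on UNIV \<rho>"
      "0 < s \<Longrightarrow> emeasure lebesgue {y \<in> \<Omega> j. \<rho> y < s} = ennreal (min s L)" for s
    using rank_function[OF \<Omega>j] by (simp_all add: \<rho>_def L_def)
  \<comment> \<open>Continuity makes \<rho> Borel and not merely Lebesgue measurable, so its
    composition with a coordinate projection is measurable.\<close>
  have [measurable]: "\<rho> \<in> borel_measurable borel" using rank(1) by (rule borel_measurable_continuous_onI)
  have \<rho>_meas: "(\<lambda>x. \<rho> (x j)) \<in> borel_measurable (box_measure d \<Omega>)"
  proof -
    have "(\<lambda>x. x j) \<in> measurable (Pi\<^sub>M {..<d} (\<lambda>_. lborel)) lborel"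
      using j(1) by (intro measurable_component_singleton) simp
    then have "(\<lambda>x. \<rho> (x j)) \<in> borel_measurable (Pi\<^sub>M {..<d} (\<lambda>_. lborel))"
      by (rule measurable_compose) simp
    then show ?thesis unfolding box_measure_def
      by (intro measurable_restrict_space1 measurable_completion)
  qed
  have E: "{y \<in> \<Omega> j. \<rho> y < s} \<in> sets lebesgue" for s
  proof -
    have "{y \<in> space borel. \<rho> y < s} \<in> sets borel" by measurable
    then have "{y. \<rho> y < s} \<in> sets lebesgue" by (simp add: borel_closed)
    then have "\<Omega> j \<inter> {y. \<rho> y < s} \<in> sets lebesgue" using assms(2)[OF j(1)] by (rule sets.Int[rotated])
    then show ?thesis by (simp add: Collect_conj_eq)
  qed
  have level: "{x \<in> box_set d \<Omega>. \<rho> (x j) < s} = PiE {..<d} (fun_upd \<Omega> j {y \<in> \<Omega> j. \<rho> y < s})" for s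
  proof (intro equalityI subsetI)
    fix x assume x: "x \<in> {x \<in> box_set d \<Omega>. \<rho> (x j) < s}"
    then have "x \<in> PiE {..<d} \<Omega>" by (simp add: box_set_def)
    from PiE_mem[OF this] PiE_arb[OF this] x
    show "x \<in> PiE {..<d} (fun_upd \<Omega> j {y \<in> \<Omega> j. \<rho> y < s})" by (intro PiE_I) auto
  next
    fix x assume x: "x \<in> PiE {..<d} (fun_upd \<Omega> j {y \<in> \<Omega> j. \<rho> y < s})"
    have "\<rho> (x j) < s" using PiE_mem[OF x, of j] j(1) by simp
    moreover have "PiE {..<d} (fun_upd \<Omega> j {y \<in> \<Omega> j. \<rho> y < s}) \<subseteq> PiE {..<d} \<Omega>"
      by (rule PiE_mono) auto
    ultimately show "x \<in> {x \<in> box_set d \<Omega>. \<rho> (x j) < s}"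
      using x unfolding box_set_def by blast
  qed
  \<comment> \<open>The empty set is the cylinder over the empty side, so the cylinder formula also
    gives the norm of the zero function.\<close>
  have "PiE {..<d} (fun_upd \<Omega> j {}) = {}" using j(1) by (auto simp: PiE_eq_empty_iff)
  then have N0: "mixed_norm d \<Omega> p (indicat_real {}) = 0"
    using C(2)[rule_format, of "{}"] by simp
  have space: "mixed_lorentz_space d \<Omega> p q
      = {f \<in> borel_measurable (box_measure d \<Omega>). mixed_lorentz_norm d \<Omega> p q f < top}"
    by (simp add: mixed_lorentz_space_def)
  show ?thesis
    unfolding space m_def[symmetric]
  proof (rule has_growth_envelope_lorentz[OF m(1) assms(8) C(1) K(1) L _ c(1) _ \<rho>_meas, where
        N = "\<lambda>A. mixed_norm d \<Omega> p (indicat_real A)"])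
    show "emeasure (box_measure d \<Omega>) (space (box_measure d \<Omega>)) < top" using assms(4) by simp
    show "mixed_norm d \<Omega> p (indicat_real {x \<in> space (box_measure d \<Omega>). \<rho> (x j) < s})
        = ennreal (C * min s L powr (1 / m))" if s: "0 < s" for s
      using C(2)[rule_format, OF E[of s]] rank(2)[OF s] s L C(1) by (simp add: level enn_powr_ennreal ennreal_mult)
    show "emeasure (box_measure d \<Omega>) {x \<in> space (box_measure d \<Omega>). \<rho> (x j) < s} = ennreal (K * min s L)"
      if s: "0 < s" for s
      using K(2)[rule_format, OF E[of s]] rank(2)[OF s] s L K(1) by (simp add: level ennreal_mult)
    show "mixed_lorentz_norm d \<Omega> p q f = lorentz_qnorm q
        (\<lambda>u. mixed_norm d \<Omega> p (indicat_real {x \<in> space (box_measure d \<Omega>). \<bar>f x\<bar> > u}))" for f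
      unfolding space_box_measure by (rule mixed_lorentz_norm_eq)
    show "ennreal c * enn_powr (emeasure (box_measure d \<Omega>) A) (1 / m) \<le> mixed_norm d \<Omega> p (indicat_real A)"
      if "A \<in> sets (box_measure d \<Omega>)" for A
      using c(2) that by (rule bspec)
  qed (fact N0)
qed

end
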